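(* Assume the setting below. Suppose: (1) $\lambda>\chi^+$ is such that $\mathcal N$ is stable in $\mu$ for unboundedly many $\mu<\lambda$; (2) $\langle M_i:i<\delta\rangle$ is an increasing sequence of $\lambda$-saturated models, and $M_\delta:=\bigcup_{i<\delta}M_i$; (3) for every $q\in S(M_\delta)$ there exist a splitting-like notion $R$, some $i<\delta$, and $A\subseteq|M_i|$ with $|A|\le\chi_0$ such that $q$ does not $R$-split over $A$. Then $M_\delta$ is $\lambda$-saturated.
   Context: Setting: $\kappa$ infinite cardinal, $L$ a $(<\kappa)$-ary language, $\mathcal N$ a fixed $L$-structure; we work inside $\mathcal N$. Formulas are quantifier-free $L_{\kappa,\kappa}$; $\mathrm{tp}(\bar c/A)$ is the quantifier-free $L_{\kappa,\kappa}$-type in $\mathcal N$; $S^\alpha(A)$ the complete such types of length $\alpha$ over $A$ realized in $\mathcal N$, $S(A)=S^1(A)$; tuples have length $<\kappa$. A family $\mathcal S\subseteq\mathcal P(|\mathcal N|)$ of "models" is closed under unions of increasing chains and satisfies: if $A\subseteq B$, $A\in\mathcal S$, there is $A'\in\mathcal S$, $A\subseteq A'\subseteq B$, $|A'|\le(|L|+2)^{<\kappa}+|A|$. $M$ is $\lambda$-saturated for types of length $\alpha$ if every $p\in S^\alpha(A)$, $A\subseteq|M|$, $|A|<\lambda$, is realized in $M$; $\lambda$-saturated means for all lengths $<\kappa$. Standing assumption: for $\mu>(|L|+2)^{<\kappa}$, $\mu$-saturated for types of length one implies $\mu$-saturated. $\mathcal N$ is stable in $\mu$ if $|S(A)|\le\mu$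 whenever $|A|\le\mu$. $\mathcal N$ has the order property of length $\theta$ if some formula $\phi(\bar x,\bar y)$ and tuples $\langle\bar a_i:i<\theta\rangle$ satisfy $\models\phi[\bar a_i,\bar a_j]$ iff $i<j$. Standing assumptions: $\chi_0\ge(|L|+2)^{<\kappa}$, $\mathcal N$ does not have the order property of length $\chi_0^+$, and $\chi:=(2^{2^{\chi_0}})^+$. A set of formulas $p$ splits over $A$ if there are $\phi(\bar x,\bar b)\in p$ and $\bar b'$ with $\mathrm{tp}(\bar b'/A)=\mathrm{tp}(\bar b/A)$ and $\neg\phi(\bar x,\bar b')\in p$. A splitting-like notion is a relation $R(p,A)$ ("$p$ does not $R$-split over $A$") for $p\in S^{<\infty}(B)$, $A\subseteq B$, such that: (monotonicity) $A\subseteq A'\subseteq B_0\subseteq B$ and $R(p,A)$ imply $R(p\restriction B_0,A')$; (weak uniqueness) if $A\subseteq|M|\subseteq B$, $M$ is $(|A|+(|L|+2)^{<\kappa})^+$-saturated, $q_1,q_2\in S^{<\infty}(B)$, $R(q_\ell,A)$ and $q_1\restriction M=q_2\restriction M$, then $q_1=q_2$; (extends nonsplitting) if $p\in S^{<\infty}(B)$ does not split over $A\subseteq B$ then $R(p,A)$.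
   Formalization: The Löwenheim–Skolem condition on the family of models is taken with "B in S" and A an arbitrary subset of B, instead of the printed "A in S", which holds trivially (A'=A) and under which the theorem is false. *)

theory Defs
  imports Main "HOL-Library.FuncSet"
begin

unbundle cardinal_syntax

text \<open>
  A cardinal is a relation \<open>k\<close> with \<open>Card_order k\<close>.  The ordinals below \<open>k\<close> are the elements of
  \<open>Field k\<close>, an element \<open>\<alpha>\<close> standing for the order type of its set \<open>underS k \<alpha>\<close> of predecessors.
  Accordingly, a tuple of length \<open>\<alpha>\<close> is an extensional function on \<open>underS k \<alpha>\<close>.
\<close>

definition tup :: "'k rel \<Rightarrow> 'k \<Rightarrow> 'a set \<Rightarrow> ('k \<Rightarrow> 'a) set" where
  "tup k \<alpha> A = underS k \<alpha> \<rightarrow>\<^sub>E A"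

definition ord_one :: "'k rel \<Rightarrow> 'k" where
  "ord_one k = (THE \<alpha>. \<alpha> \<in> Field k \<and> card (underS k \<alpha>) = 1)"


section \<open>Languages, structures, formulas\<close>

record ('f, 'r, 'k) lang =
  Funs :: "'f set"
  Rels :: "'r set"
  fun_arity :: "'f \<Rightarrow> 'k"
  rel_arity :: "'r \<Rightarrow> 'k"

text \<open>The universe of a structure is the type \<open>'a\<close>.\<close>

record ('f, 'r, 'k, 'a) struct = "('f, 'r, 'k) lang" +
  fun_int :: "'f \<Rightarrow> ('k \<Rightarrow> 'a) \<Rightarrow> 'a"
  rel_int :: "'r \<Rightarrow> ('k \<Rightarrow> 'a) \<Rightarrow> bool"

definition lt_ary :: "'k rel \<Rightarrow> ('f, 'r, 'k, 'z) lang_scheme \<Rightarrow> bool" where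
  "lt_ary k L \<longleftrightarrow> (\<forall>f\<in>Funs L. fun_arity L f \<in> Field k) \<and> (\<forall>R\<in>Rels L. rel_arity L R \<in> Field k)"

text \<open>
  The cardinal \<open>(|L| + 2)\<close> to the power \<open><k\<close>, as the number of sequences of length \<open><k\<close> in a set of
  size \<open>|L| + 2\<close>; as the base is at least 2, this agrees with the supremum of the powers
  with exponents below \<open>k\<close>.
\<close>

type_synonym ('f, 'r, 'k) lseq = "'k \<times> ('k \<Rightarrow> ('f + 'r) + bool)"

definition lang_pow :: "'k rel \<Rightarrow> ('f, 'r, 'k, 'z) lang_scheme \<Rightarrow> ('f, 'r, 'k) lseq rel" where
  "lang_pow k L = |Sigma (Field k) (\<lambda>\<alpha>. tup k \<alpha> ((Funs L <+> Rels L) <+> UNIV))|"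

text \<open>
  In \<open>Fn f ts\<close>, \<open>Rel R ts\<close> and \<open>Conj \<alpha> F\<close> only the components with index below the
  arity of \<open>f\<close>, the arity of \<open>R\<close>, and \<open>\<alpha>\<close>, respectively, are meaningful.  Disjunctions of
  fewer than \<open>k\<close> formulas are expressed through \<open>Conj\<close> and \<open>Neg\<close>.
\<close>

datatype (dead 'f, dead 'k, 'v) tm =
  Var 'v
| Fn 'f "'k \<Rightarrow> ('f, 'k, 'v) tm"

datatype (dead 'f, dead 'r, dead 'k, 'v) fm =
  Eq "('f, 'k, 'v) tm" "('f, 'k, 'v) tm"
| Rel 'r "'k \<Rightarrow> ('f, 'k, 'v) tm"
| Neg "('f, 'r, 'k, 'v) fm"
| Conj 'k "'k \<Rightarrow> ('f, 'r, 'k, 'v) fm"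

text \<open>Terms and quantifier-free \<open>L\<^sub>k\<^sub>,\<^sub>k\<close>-formulas of the language \<open>L\<close>, with variables in \<open>V\<close>.\<close>

primrec wf_tm :: "'k rel \<Rightarrow> ('f, 'r, 'k, 'z) lang_scheme \<Rightarrow> 'v set \<Rightarrow> ('f, 'k, 'v) tm \<Rightarrow> bool" where
  "wf_tm k L V (Var v) \<longleftrightarrow> v \<in> V"
| "wf_tm k L V (Fn f ts) \<longleftrightarrow> f \<in> Funs L \<and> (\<forall>i\<in>underS k (fun_arity L f). wf_tm k L V (ts i))"

primrec wf_fm :: "'k rel \<Rightarrow> ('f, 'r, 'k, 'z) lang_scheme \<Rightarrow> 'v set \<Rightarrow> ('f, 'r, 'k, 'v) fm \<Rightarrow> bool" where
  "wf_fm k L V (Eq s t) \<longleftrightarrow> wf_tm k L V s \<and> wf_tm k L V t"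
| "wf_fm k L V (Rel R ts) \<longleftrightarrow> R \<in> Rels L \<and> (\<forall>i\<in>underS k (rel_arity L R). wf_tm k L V (ts i))"
| "wf_fm k L V (Neg \<phi>) \<longleftrightarrow> wf_fm k L V \<phi>"
| "wf_fm k L V (Conj \<alpha> F) \<longleftrightarrow> \<alpha> \<in> Field k \<and> (\<forall>i\<in>underS k \<alpha>. wf_fm k L V (F i))"

primrec tm_val :: "'k rel \<Rightarrow> ('f, 'r, 'k, 'a, 'z) struct_scheme \<Rightarrow> ('v \<Rightarrow> 'a) \<Rightarrow> ('f, 'k, 'v) tm \<Rightarrow> 'a" where
  "tm_val k N e (Var v) = e v"
| "tm_val k N e (Fn f ts) = fun_int N f (\<lambda>i\<in>underS k (fun_arity N f). tm_val k N e (ts i))"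

primrec holds :: "'k rel \<Rightarrow> ('f, 'r, 'k, 'a, 'z) struct_scheme \<Rightarrow> ('v \<Rightarrow> 'a) \<Rightarrow> ('f, 'r, 'k, 'v) fm \<Rightarrow> bool" where
  "holds k N e (Eq s t) \<longleftrightarrow> tm_val k N e s = tm_val k N e t"
| "holds k N e (Rel R ts) \<longleftrightarrow> rel_int N R (\<lambda>i\<in>underS k (rel_arity N R). tm_val k N e (ts i))"
| "holds k N e (Neg \<phi>) \<longleftrightarrow> \<not> holds k N e \<phi>"
| "holds k N e (Conj \<alpha> F) \<longleftrightarrow> (\<forall>i\<in>underS k \<alpha>. holds k N e (F i))"

text \<open>
  A formula \<open>\<phi>(x, y)\<close> in two tuples of variables has variables \<open>Inl i\<close> for the components of \<open>x\<close>
  and \<open>Inr j\<close> for those of \<open>y\<close>.  Plugging in parameters \<open>b\<close> for \<open>y\<close> gives \<open>\<phi>(x, b)\<close>, in which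
  \<open>Inr a\<close> stands for the parameter \<open>a\<close>.
\<close>

definition qf :: "'k rel \<Rightarrow> ('f, 'r, 'k, 'z) lang_scheme \<Rightarrow> 'k \<Rightarrow> 'k \<Rightarrow> ('f, 'r, 'k, 'k + 'k) fm set" where
  "qf k L \<alpha> \<beta> = {\<phi>. wf_fm k L (underS k \<alpha> <+> underS k \<beta>) \<phi>}"

definition inst :: "('k \<Rightarrow> 'a) \<Rightarrow> ('f, 'r, 'k, 'k + 'k) fm \<Rightarrow> ('f, 'r, 'k, 'k + 'a) fm" where
  "inst b \<phi> = map_fm (map_sum id b) \<phi>"

type_synonym ('f, 'r, 'k, 'a) qf_type = "('f, 'r, 'k, 'k + 'a) fm set"


section \<open>Types, saturation, stability\<close>

definition tp :: "'k rel \<Rightarrow> ('f, 'r, 'k, 'a, 'z) struct_scheme \<Rightarrow> 'k \<Rightarrow> ('k \<Rightarrow> 'a) \<Rightarrow> 'a set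
    \<Rightarrow> ('f, 'r, 'k, 'a) qf_type" where
  "tp k N \<alpha> c A = {inst b \<phi> | \<beta> b \<phi>. \<beta> \<in> Field k \<and> b \<in> tup k \<beta> A \<and> \<phi> \<in> qf k N \<alpha> \<beta> \<and>
      holds k N (case_sum c b) \<phi>}"

definition types :: "'k rel \<Rightarrow> ('f, 'r, 'k, 'a, 'z) struct_scheme \<Rightarrow> 'k \<Rightarrow> 'a set
    \<Rightarrow> ('f, 'r, 'k, 'a) qf_type set" where
  "types k N \<alpha> A = {tp k N \<alpha> c A | c. c \<in> tup k \<alpha> UNIV}"

definition all_types :: "'k rel \<Rightarrow> ('f, 'r, 'k, 'a, 'z) struct_scheme \<Rightarrow> 'a set
    \<Rightarrow> ('f, 'r, 'k, 'a) qf_type set" where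
  "all_types k N A = (\<Union>\<alpha>\<in>Field k. types k N \<alpha> A)"

definition type_restr :: "'k rel \<Rightarrow> ('f, 'r, 'k, 'a, 'z) struct_scheme \<Rightarrow> ('f, 'r, 'k, 'a) qf_type
    \<Rightarrow> 'a set \<Rightarrow> ('f, 'r, 'k, 'a) qf_type" where
  "type_restr k N p B = p \<inter> {inst b \<phi> | \<alpha> \<beta> b \<phi>.
      \<alpha> \<in> Field k \<and> \<beta> \<in> Field k \<and> b \<in> tup k \<beta> B \<and> \<phi> \<in> qf k N \<alpha> \<beta>}"

definition saturated_for :: "'k rel \<Rightarrow> ('f, 'r, 'k, 'a, 'z) struct_scheme \<Rightarrow> 'k \<Rightarrow> 'l rel
    \<Rightarrow> 'a set \<Rightarrow> bool" where
  "saturated_for k N \<alpha> l M \<longleftrightarrow>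
     (\<forall>A p. A \<subseteq> M \<and> |A| <o l \<and> p \<in> types k N \<alpha> A \<longrightarrow> (\<exists>c\<in>tup k \<alpha> M. tp k N \<alpha> c A = p))"

definition saturated :: "'k rel \<Rightarrow> ('f, 'r, 'k, 'a, 'z) struct_scheme \<Rightarrow> 'l rel \<Rightarrow> 'a set \<Rightarrow> bool" where
  "saturated k N l M \<longleftrightarrow> (\<forall>\<alpha>\<in>Field k. saturated_for k N \<alpha> l M)"

definition stable_in :: "'k rel \<Rightarrow> ('f, 'r, 'k, 'a, 'z) struct_scheme \<Rightarrow> 'm rel \<Rightarrow> bool" where
  "stable_in k N \<mu> \<longleftrightarrow> (\<forall>A. |A| \<le>o \<mu> \<longrightarrow> |types k N (ord_one k) A| \<le>o \<mu>)"

definition order_property :: "'k rel \<Rightarrow> ('f, 'r, 'k, 'a, 'z) struct_scheme \<Rightarrow> 't rel \<Rightarrow> bool" where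
  "order_property k N \<theta> \<longleftrightarrow>
     (\<exists>\<alpha>\<in>Field k. \<exists>\<phi>\<in>qf k N \<alpha> \<alpha>. \<exists>a. (\<forall>i\<in>Field \<theta>. a i \<in> tup k \<alpha> UNIV) \<and>
       (\<forall>i\<in>Field \<theta>. \<forall>j\<in>Field \<theta>. holds k N (case_sum (a i) (a j)) \<phi> \<longleftrightarrow> (i, j) \<in> \<theta> \<and> i \<noteq> j))"


section \<open>Models\<close>

definition increasing :: "'d rel \<Rightarrow> ('d \<Rightarrow> 'a set) \<Rightarrow> bool" where
  "increasing \<delta> M \<longleftrightarrow> (\<forall>i j. (i, j) \<in> \<delta> \<longrightarrow> M i \<subseteq> M j)"

text \<open>
  The range of an increasing transfinite sequence of subsets of \<open>'a\<close> is well-ordered by inclusion,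
  so after deleting repetitions the sequence is indexed by a well-order on the type \<open>'a set\<close>.
\<close>

definition chain_closed :: "'a set set \<Rightarrow> bool" where
  "chain_closed S \<longleftrightarrow>
     (\<forall>(\<delta> :: 'a set rel) M. Well_order \<delta> \<and> Field \<delta> \<noteq> {} \<and> increasing \<delta> M \<and> (\<forall>i\<in>Field \<delta>. M i \<in> S)
        \<longrightarrow> (\<Union>i\<in>Field \<delta>. M i) \<in> S)"

definition lowenheim_skolem :: "'k rel \<Rightarrow> ('f, 'r, 'k, 'a, 'z) struct_scheme \<Rightarrow> 'a set set \<Rightarrow> bool" where
  "lowenheim_skolem k N S \<longleftrightarrow>
     (\<forall>A B. A \<subseteq> B \<and> B \<in> S \<longrightarrow> (\<exists>A'\<in>S. A \<subseteq> A' \<and> A' \<subseteq> B \<and> |A'| \<le>o lang_pow k N +c |A| ))"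

text \<open>
  The type of \<open>\<mu>\<close> carries the successor of some cardinal bounding both the universe and
  \<open>lang_pow k N\<close>.  For larger \<open>\<mu>\<close>, being \<open>\<mu>\<close>-saturated means the same as for that successor,
  as the size of a parameter set is at most that of the universe.  So no cardinal is missed.
\<close>

definition saturation_from_length_one :: "'k rel \<Rightarrow> ('f, 'r, 'k, 'a, 'z) struct_scheme
    \<Rightarrow> 'a set set \<Rightarrow> bool" where
  "saturation_from_length_one k N S \<longleftrightarrow>
     (\<forall>(\<mu> :: ('a + ('f, 'r, 'k) lseq) set rel) M.
        Card_order \<mu> \<and> lang_pow k N <o \<mu> \<and> M \<in> S \<and> saturated_for k N (ord_one k) \<mu> M
        \<longrightarrow> saturated k N \<mu> M)"


section \<open>Splitting\<close>

definition splits :: "'k rel \<Rightarrow> ('f, 'r, 'k, 'a, 'z) struct_scheme \<Rightarrow> ('f, 'r, 'k, 'a) qf_type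
    \<Rightarrow> 'a set \<Rightarrow> bool" where
  "splits k N p A \<longleftrightarrow>
     (\<exists>\<alpha>\<in>Field k. \<exists>\<beta>\<in>Field k. \<exists>\<phi>\<in>qf k N \<alpha> \<beta>. \<exists>b\<in>tup k \<beta> UNIV. \<exists>b'\<in>tup k \<beta> UNIV.
        inst b \<phi> \<in> p \<and> tp k N \<beta> b' A = tp k N \<beta> b A \<and> Neg (inst b' \<phi>) \<in> p)"

text \<open>
  \<open>R p A\<close> reads ``\<open>p\<close> does not \<open>R\<close>-split over \<open>A\<close>''.  The base \<open>B\<close> of a type \<open>p\<close> over \<open>B\<close>
  is determined by \<open>p\<close>, which contains \<open>a = a\<close> exactly for the parameters \<open>a\<close> in \<open>B\<close>.
\<close>

definition splitting_like :: "'k rel \<Rightarrow> ('f, 'r, 'k, 'a, 'z) struct_scheme \<Rightarrow> 'a set set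
    \<Rightarrow> (('f, 'r, 'k, 'a) qf_type \<Rightarrow> 'a set \<Rightarrow> bool) \<Rightarrow> bool" where
  "splitting_like k N S R \<longleftrightarrow>
     (\<forall>B p A A' B\<^sub>0. p \<in> all_types k N B \<and> A \<subseteq> A' \<and> A' \<subseteq> B\<^sub>0 \<and> B\<^sub>0 \<subseteq> B \<and> R p A
        \<longrightarrow> R (type_restr k N p B\<^sub>0) A') \<and>
     (\<forall>B M A q\<^sub>1 q\<^sub>2. M \<in> S \<and> A \<subseteq> M \<and> M \<subseteq> B \<and> saturated k N (cardSuc ( |A| +c lang_pow k N)) M \<and>
        q\<^sub>1 \<in> all_types k N B \<and> q\<^sub>2 \<in> all_types k N B \<and> R q\<^sub>1 A \<and> R q\<^sub>2 A \<and>
        type_restr k N q\<^sub>1 M = type_restr k N q\<^sub>2 M \<longrightarrow> q\<^sub>1 = q\<^sub>2) \<and>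
     (\<forall>B p A. p \<in> all_types k N B \<and> A \<subseteq> B \<and> \<not> splits k N p A \<longrightarrow> R p A)"

end

(*
  Fix a realization c of a type over the union and let M be a model of the chain over which
  tp(c/M) has its R-nonsplitting base.  The absence of the order property gives a set of size at
  most 2^chi0 over which tp(c/M) does not split.  Stability in mu < l yields inside M an increasing
  chain of length mu^+ of small saturated models, with elements a_xi realizing tp(c/K_xi).  For
  every formula and parameter tuple all but chi0 many a_xi agree with the value predicted by
  nonsplitting; otherwise copying the tuple into the chain produces an order of length chi0^+.
  Counting types over the given small set B (together with the first model), some type is realized
  by more than chi0 many a_xi.  That type does not split, hence does not R-split, and it agrees
  with tp(c) on a saturated model, so by weak uniqueness it extends tp(c/B).
*)

theory Submission
  imports Defs
begin

section \<open>Cardinals and well-orders\<close>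

text \<open>The parameter set B may be spread over cofinally many models of the chain, whose
  cofinality may be small. No single model then realizes the type over B by its own saturation, and
  nonsplitting of tp(c/M) says nothing about parameters outside M. The elements a_xi lie inside M,
  but their types may be taken over any set; this carries information about tp(c/M) over to B. Weak
  uniqueness compares two types that both do not R-split, and for the type built from the a_xi only
  ordinary nonsplitting is available to supply this. The constants: a sequence of length mu^+ beats
  the at most mu types over a set of size mu, and chi0^+ repetitions beat the at most chi0
  exceptions to one instance of a formula. The number of formulas is bounded by 2^chi0, which
  therefore becomes the size of nonsplitting bases and makes (2^chi0)^+ the degree of saturation of
  the small models. As lambda may be singular, each B is treated with its own stability cardinal mu,
  chosen between |B| and lambda.\<close>

lemma underS_subset_Field: "underS r a \<subseteq> Field r"
  by (auto simp: underS_def Field_def)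

lemma wf_minus_Id: "Well_order r \<Longrightarrow> wf (r - Id)"
  by (simp add: well_order_on_def)

text \<open>Lengths of tuples are elements of \<open>Field r\<close>, while the index sets met below
  are singletons, two-element sets and disjoint sums. A set smaller than \<open>r\<close> has the
  order type of a proper initial segment, so its elements can be renamed into such a length.\<close>

lemma ex_bij_betw_underS:
  assumes "Card_order r" and "|X| <o r"
  obtains \<alpha> h where "\<alpha> \<in> Field r" and "bij_betw h X (underS r \<alpha>)"
proof -
  have wo: "Well_order r"
    using assms(1) card_order_on_well_order_on by blast
  obtain \<alpha> where \<alpha>: "\<alpha> \<in> Field r" and iso: "|X| =o Restr r (underS r \<alpha>)"
    using assms(2) ordLess_iff_ordIso_Restr[OF wo card_of_Well_order] by blast
  have "Field (Restr r (underS r \<alpha>)) = underS r \<alpha>"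
    using wo by (simp add: Field_Restr_ofilter wo_rel.intro wo_rel.underS_ofilter)
  then obtain h where "bij_betw h X (underS r \<alpha>)"
    using iso unfolding ordIso_def iso_def by (auto simp: Field_card_of)
  with \<alpha> that show ?thesis by blast
qed

lemma card_of_lists_of_length:
  fixes A :: "'b set"
  assumes "Cinfinite r" and "|A| \<le>o r"
  shows "|{xs \<in> lists A. length xs = n}| \<le>o r"
proof (induction n)
  case 0
  have "{xs \<in> lists A. length xs = 0} = {[]}" by auto
  moreover have "Cfinite |{[] :: 'b list}|"
    using card_of_Card_order by (auto simp: cfinite_def Field_card_of)
  ultimately show ?case
    using ordLess_imp_ordLeq[OF Cfinite_ordLess_Cinfinite[OF _ assms(1)]] by simp
next
  case (Suc n)
  have "{xs \<in> lists A. length xs = Suc n} =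
      (\<lambda>(x, xs). x # xs) ` (A \<times> {xs \<in> lists A. length xs = n})"
    by (auto simp: length_Suc_conv image_iff)
  moreover have "|A \<times> {xs \<in> lists A. length xs = n}| \<le>o r"
    using assms Suc by (simp add: card_of_Times_ordLeq_infinite_Field cinfinite_def)
  ultimately show ?case
    using ordLeq_transitive[OF card_of_image] by simp
qed

lemma card_of_lists:
  assumes "Cinfinite r" and "|A| \<le>o r"
  shows "|lists A| \<le>o r"
proof -
  have "lists A = (\<Union>n\<in>UNIV. {xs \<in> lists A. length xs = n})" by auto
  moreover have "|UNIV :: nat set| \<le>o r"
    using assms(1) card_of_nat natLeq_ordLeq_cinfinite ordIso_ordLeq_trans by blast
  ultimately show ?thesis
    using UNION_Cinfinite_bound[OF _ _ assms(1), of UNIV "\<lambda>n. {xs \<in> lists A. length xs = n}"]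
      card_of_lists_of_length[OF assms] by simp
qed

lemma card_of_Pow_ordLeq:
  assumes "Card_order r" and "|X| \<le>o r"
  shows "|Pow X| \<le>o ctwo ^c r"
proof -
  have "|X| \<le>o |Field r|"
    using assms card_of_Field_ordIso ordLeq_ordIso_trans ordIso_symmetric by blast
  then obtain f where f: "inj_on f X" "f ` X \<subseteq> Field r"
    using card_of_ordLeq[of X "Field r"] by blast
  have "inj_on ((`) f) (Pow X)" "(`) f ` Pow X \<subseteq> Pow (Field r)"
    using f by (auto simp: inj_on_image_Pow)
  then have "|Pow X| \<le>o |Pow (Field r)|"
    using card_of_ordLeq[of "Pow X" "Pow (Field r)"] by blast
  also have "|Pow (Field r)| =o |Func (Field r) (UNIV :: bool set)|"
    by (rule card_of_Pow_Func)
  also have "|Func (Field r) (UNIV :: bool set)| = ctwo ^c r"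
    by (simp add: cexp_def ctwo_def Field_card_of)
  finally show ?thesis .
qed

text \<open>If all fibres had size at most \<open>r\<close>, then at most \<open>r\<close> of them
  would cover the successor of \<open>r\<close>. A fibre larger than \<open>r\<close>, hence larger
  than \<open>s\<close>, has at least \<open>cardSuc s\<close> elements.\<close>

lemma pigeonhole_cardinal:
  fixes f :: "'r set \<Rightarrow> 'c" and r :: "'r rel" and s :: "'s rel"
  assumes r: "Cinfinite r" and s: "Card_order s" "s \<le>o r"
    and C: "f ` Field (cardSuc r) \<subseteq> C" "|C| \<le>o r"
  obtains y where "cardSuc s \<le>o |{x \<in> Field (cardSuc r). f x = y}|"
proof -
  have "\<exists>y\<in>C. \<not> |{x \<in> Field (cardSuc r). f x = y}| \<le>o r"
  proof (rule ccontr)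
    assume "\<not> ?thesis"
    then have "|\<Union>y\<in>C. {x \<in> Field (cardSuc r). f x = y}| \<le>o r"
      using r C(2) by (intro UNION_Cinfinite_bound) auto
    moreover have "(\<Union>y\<in>C. {x \<in> Field (cardSuc r). f x = y}) = Field (cardSuc r)"
      using C(1) by auto
    ultimately have "|Field (cardSuc r)| \<le>o r" by simp
    then have "cardSuc r \<le>o r"
      using card_of_Field_ordIso[OF cardSuc_Card_order] r ordIso_ordLeq_trans ordIso_symmetric
      by blast
    then show False
      using cardSuc_greater r not_ordLess_ordLeq by blast
  qed
  then obtain y where "\<not> |{x \<in> Field (cardSuc r). f x = y}| \<le>o r" by blast
  then have "r <o |{x \<in> Field (cardSuc r). f x = y}|"
    using not_ordLeq_iff_ordLess[OF card_order_on_well_order_on card_of_Well_order] r by blast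
  then have "s <o |{x \<in> Field (cardSuc r). f x = y}|"
    using s(2) ordLeq_ordLess_trans by blast
  then show ?thesis
    using that[OF cardSuc_least[OF s(1) card_of_Card_order]] by simp
qed

text \<open>\<open>X\<close> with the inherited order is a well-order, hence at least as long as the
  cardinal of \<open>X\<close>, and \<open>s\<close> embeds into it. This thins a sequence to an
  increasing subsequence of length \<chi>^+.\<close>

lemma ex_strict_mono_into_subset:
  assumes "Well_order s" and r: "Well_order r" and "X \<subseteq> Field r" and "s \<le>o |X|"
  obtains g where "\<And>i. i \<in> Field s \<Longrightarrow> g i \<in> X"
    and "\<And>i j. i \<in> Field s \<Longrightarrow> j \<in> Field s \<Longrightarrow> i \<noteq> j \<Longrightarrow> (i, j) \<in> s \<Longrightarrow> g i \<in> underS r (g j)"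
proof -
  have X: "Well_order (Restr r X)" "Field (Restr r X) = X"
    using Well_order_Restr[OF r] Refl_Field_Restr2[of r X] r assms(3) unfolding order_on_defs
    by (blast, blast)
  then have "s \<le>o Restr r X"
    using ordLeq_transitive[OF assms(4) card_of_least] by (simp add: X)
  then obtain g where g: "embed s (Restr r X) g"
    unfolding ordLeq_def by blast
  show ?thesis
  proof (rule that[of g])
    show "g i \<in> X" if "i \<in> Field s" for i
      using embed_in_Field[OF g that] X by simp
    show "g i \<in> underS r (g j)" if "i \<in> Field s" "j \<in> Field s" "i \<noteq> j" "(i, j) \<in> s" for i j
      using embed_compat[OF g] embed_inj_on[OF assms(1) g] that
      by (auto simp: compat_def underS_def inj_on_def)
  qed
qed

lemma card_of_UNION_underS:
  assumes "Cinfinite r" and "\<And>\<eta>. \<eta> \<in> underS (cardSuc r) \<xi> \<Longrightarrow> |A \<eta>| \<le>o r"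
  shows "|\<Union>\<eta>\<in>underS (cardSuc r) \<xi>. A \<eta>| \<le>o r"
proof (cases "\<xi> \<in> Field (cardSuc r)")
  case True
  then have "|underS (cardSuc r) \<xi>| <o cardSuc r"
    using assms(1) by (simp add: card_of_underS cardSuc_Card_order)
  then have "|underS (cardSuc r) \<xi>| \<le>o r"
    using assms(1) cardSuc_ordLeq_ordLess[of r "|underS (cardSuc r) \<xi>|"] by (simp add: card_of_Card_order)
  then show ?thesis
    using assms by (intro UNION_Cinfinite_bound) auto
next
  \<comment> \<open>The recursions below run over all elements of the type, also those outside the
    field of the cardinal; these have no predecessors.\<close>
  case False
  then have "underS (cardSuc r) \<xi> = {}"
    by (auto simp: underS_def Field_def)
  then show ?thesis
    using assms(1) by (simp add: card_of_empty1 card_order_on_well_order_on)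
qed

text \<open>Passes from the index type fixed in \<open>chain_closed\<close> to an arbitrary one: the
  range of \<open>M\<close>, ordered by inclusion, is a well-order on \<open>'a set\<close>, since
  in any part of the range the member of least index is the least set.\<close>

lemma chain_closed_Union:
  fixes S :: "'a set set" and \<delta> :: "'d rel"
  assumes S: "chain_closed S" and \<delta>: "Well_order \<delta>" "Field \<delta> \<noteq> {}"
    and M: "increasing \<delta> M" "\<And>i. i \<in> Field \<delta> \<Longrightarrow> M i \<in> S"
  shows "(\<Union>i\<in>Field \<delta>. M i) \<in> S"
proof -
  define r where "r = {(X, Y). X \<in> M ` Field \<delta> \<and> Y \<in> M ` Field \<delta> \<and> X \<subseteq> Y}"
  have F: "Field r = M ` Field \<delta>"
    by (auto simp: r_def Field_def)
  interpret wo_rel \<delta> using \<delta>(1) by (simp add: wo_rel_def)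
  have tot: "M i \<subseteq> M j \<or> M j \<subseteq> M i" if "i \<in> Field \<delta>" "j \<in> Field \<delta>" for i j
    using that M(1) TOTALS unfolding increasing_def by blast
  have "Linear_order r"
    unfolding order_on_defs F
    using tot by (auto simp: refl_on_def trans_def antisym_def total_on_def r_def)
  moreover have "wf (r - Id)"
  proof (rule wfI_min)
    fix X Q assume X: "X \<in> (Q :: 'a set set)"
    show "\<exists>Z\<in>Q. \<forall>Y. (Y, Z) \<in> r - Id \<longrightarrow> Y \<notin> Q"
    proof (cases "Q \<inter> M ` Field \<delta> = {}")
      case True
      then show ?thesis using X by (auto simp: r_def)
    next
      case False
      define I where "I = {i \<in> Field \<delta>. M i \<in> Q}"
      have I: "I \<subseteq> Field \<delta>" "I \<noteq> {}" using False by (auto simp: I_def)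
      have m: "minim I \<in> I" using minim_in[OF I] .
      have "Y \<notin> Q" if Y: "(Y, M (minim I)) \<in> r - Id" for Y
      proof
        assume "Y \<in> Q"
        then obtain j where j: "j \<in> I" "Y = M j"
          using Y unfolding I_def r_def by blast
        then have "(minim I, j) \<in> \<delta>" using minim_least[OF I(1)] by blast
        then have "M (minim I) \<subseteq> Y" using M(1) j by (auto simp: increasing_def)
        then show False using Y by (auto simp: r_def)
      qed
      moreover have "M (minim I) \<in> Q" using m unfolding I_def by blast
      ultimately show ?thesis by blast
    qed
  qed
  ultimately have "Well_order r" by (simp add: well_order_on_def)
  moreover have "increasing r (\<lambda>X. X)" by (auto simp: increasing_def r_def)
  moreover have "Field r \<noteq> {}" "\<forall>X\<in>Field r. X \<in> S"
    using \<delta>(2) M(2) F by auto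
  ultimately have "(\<Union>X\<in>Field r. X) \<in> S"
    using S[unfolded chain_closed_def, THEN spec, THEN spec, of r "\<lambda>X. X"] by simp
  then show ?thesis by (simp add: F)
qed

section \<open>Quantifier-free formulas and types\<close>

lemma tm_val_map_tm: "tm_val k N e (map_tm f t) = tm_val k N (e \<circ> f) t"
  by (induction t) auto

lemma holds_map_fm: "holds k N e (map_fm f \<phi>) \<longleftrightarrow> holds k N (e \<circ> f) \<phi>"
  by (induction \<phi>) (auto simp: tm_val_map_tm o_def)

lemma wf_tm_map_tm: "wf_tm k L V (map_tm f t) \<longleftrightarrow> wf_tm k L (f -` V) t"
  by (induction t) auto

lemma wf_fm_map_fm: "wf_fm k L V (map_fm f \<phi>) \<longleftrightarrow> wf_fm k L (f -` V) \<phi>"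
  by (induction \<phi>) (auto simp: wf_tm_map_tm)

lemma wf_tm_Int: "wf_tm k L (V \<inter> W) t \<longleftrightarrow> wf_tm k L V t \<and> wf_tm k L W t"
  by (induction t) auto

text \<open>Being well formed over a set only asks relevant variables to lie in it, so it commutes
  with intersections. This gives monotonicity, and it combines two sources of information about the
  variables of one formula in \<open>inst_in_tpD\<close>.\<close>

lemma wf_fm_Int: "wf_fm k L (V \<inter> W) \<phi> \<longleftrightarrow> wf_fm k L V \<phi> \<and> wf_fm k L W \<phi>"
  by (induction \<phi>) (auto simp: wf_tm_Int)

lemma wf_fm_mono: "wf_fm k L V \<phi> \<Longrightarrow> V \<subseteq> W \<Longrightarrow> wf_fm k L W \<phi>"
  by (metis inf.orderE wf_fm_Int)

lemma tm_val_cong: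
  "wf_tm k N V t \<Longrightarrow> (\<And>v. v \<in> V \<Longrightarrow> e v = e' v) \<Longrightarrow> tm_val k N e t = tm_val k N e' t"
proof (induction t)
  case (Fn f ts)
  then have "(\<lambda>i\<in>underS k (fun_arity N f). tm_val k N e (ts i)) =
      (\<lambda>i\<in>underS k (fun_arity N f). tm_val k N e' (ts i))"
    by (intro restrict_ext) auto
  then show ?case by (simp only: tm_val.simps)
qed simp

lemma holds_cong:
  assumes "wf_fm k N V \<phi>" and e: "\<And>v. v \<in> V \<Longrightarrow> e v = e' v"
  shows "holds k N e \<phi> \<longleftrightarrow> holds k N e' \<phi>"
  using assms(1)
proof (induction \<phi>)
  case (Rel R ts)
  then have "(\<lambda>i\<in>underS k (rel_arity N R). tm_val k N e (ts i)) =
      (\<lambda>i\<in>underS k (rel_arity N R). tm_val k N e' (ts i))"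
    using e by (intro restrict_ext tm_val_cong) auto
  then show ?case by (simp only: holds.simps)
next
  case (Eq s t)
  then show ?case
    using tm_val_cong[of k N V s e e'] tm_val_cong[of k N V t e e'] e by simp
qed auto

lemma map_fm_in_qf:
  assumes "wf_fm k L V \<phi>" and "f ` V \<subseteq> underS k \<alpha> <+> underS k \<beta>"
  shows "map_fm f \<phi> \<in> qf k L \<alpha> \<beta>"
  using wf_fm_mono[OF assms(1)] assms(2) by (simp add: qf_def wf_fm_map_fm image_subset_iff_subset_vimage)

lemma Neg_in_qf: "\<phi> \<in> qf k L \<alpha> \<beta> \<Longrightarrow> Neg \<phi> \<in> qf k L \<alpha> \<beta>"
  by (simp add: qf_def)

lemma inst_Neg: "inst b (Neg \<phi>) = Neg (inst b \<phi>)"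
  by (simp add: inst_def)

text \<open>The truth value can be read off the instance itself, because \<open>Inr\<close> there
  carries the parameter. Different pairs of formula and tuple with the same instance therefore
  agree.\<close>

lemma holds_inst: "holds k N (case_sum c id) (inst b \<phi>) \<longleftrightarrow> holds k N (case_sum c b) \<phi>"
proof -
  have "case_sum c id \<circ> map_sum id b = case_sum c b"
    by (auto split: sum.split)
  then show ?thesis by (simp add: inst_def holds_map_fm)
qed

lemma tup_mono: "A \<subseteq> B \<Longrightarrow> tup k \<alpha> A \<subseteq> tup k \<alpha> B"
  unfolding tup_def by (intro PiE_mono) auto

lemma tup_range_iff: "c \<in> tup k \<alpha> A \<longleftrightarrow> c \<in> tup k \<alpha> UNIV \<and> c ` underS k \<alpha> \<subseteq> A"
  by (auto simp: tup_def PiE_def)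

text \<open>An instance does not determine the formula and the tuple it comes from, and
  \<open>splits\<close> and \<open>type_restr\<close> allow any length \<alpha>' for the first
  variables. Truth is recovered through \<open>holds_inst\<close>; the correct length \<alpha>
  through the variables that the instance shares with a formula known to have that length.\<close>

lemma inst_in_tpD:
  assumes "inst b \<phi> \<in> tp k N \<alpha> c A" and "\<phi> \<in> qf k N \<alpha>' \<beta>"
  shows "\<phi> \<in> qf k N \<alpha> \<beta>" and "holds k N (case_sum c b) \<phi>"
proof -
  obtain \<gamma> a \<psi> where a: "inst b \<phi> = inst a \<psi>" "a \<in> tup k \<gamma> A" "\<psi> \<in> qf k N \<alpha> \<gamma>"
    "holds k N (case_sum c a) \<psi>"
    using assms(1) by (auto simp: tp_def)
  show "holds k N (case_sum c b) \<phi>"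
    using a(1,4) holds_inst by metis
  have "wf_fm k N (underS k \<alpha> <+> UNIV) (inst a \<psi>)"
    unfolding inst_def wf_fm_map_fm
    by (rule wf_fm_mono[where V = "underS k \<alpha> <+> underS k \<gamma>"]) (use a(3) in \<open>auto simp: qf_def\<close>)
  then have "wf_fm k N (map_sum id b -` (underS k \<alpha> <+> UNIV)) \<phi>"
    by (simp only: a(1)[symmetric]) (simp add: inst_def wf_fm_map_fm)
  moreover have "wf_fm k N (underS k \<alpha>' <+> underS k \<beta>) \<phi>"
    using assms(2) by (simp add: qf_def)
  ultimately have "wf_fm k N (map_sum id b -` (underS k \<alpha> <+> UNIV) \<inter> (underS k \<alpha>' <+> underS k \<beta>)) \<phi>"
    by (simp add: wf_fm_Int)
  then show "\<phi> \<in> qf k N \<alpha> \<beta>"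
    unfolding qf_def by (auto elim!: wf_fm_mono)
qed

lemma inst_in_tp_iff:
  assumes "\<beta> \<in> Field k" and "b \<in> tup k \<beta> A" and "\<phi> \<in> qf k N \<alpha> \<beta>"
  shows "inst b \<phi> \<in> tp k N \<alpha> c A \<longleftrightarrow> holds k N (case_sum c b) \<phi>"
  using assms inst_in_tpD(2) by (fastforce simp: tp_def)

lemma tp_eqD:
  assumes "tp k N \<alpha> c A = tp k N \<alpha> c' A"
    and "\<beta> \<in> Field k" and "b \<in> tup k \<beta> A" and "\<phi> \<in> qf k N \<alpha> \<beta>"
  shows "holds k N (case_sum c b) \<phi> \<longleftrightarrow> holds k N (case_sum c' b) \<phi>"
  using inst_in_tp_iff[OF assms(2-4)] assms(1) by metis

lemma tp_eq_iff:
  "tp k N \<alpha> c A = tp k N \<alpha> c' A \<longleftrightarrow>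
    (\<forall>\<beta>\<in>Field k. \<forall>b\<in>tup k \<beta> A. \<forall>\<phi>\<in>qf k N \<alpha> \<beta>.
      holds k N (case_sum c b) \<phi> \<longleftrightarrow> holds k N (case_sum c' b) \<phi>)" (is "?l \<longleftrightarrow> ?r")
proof
  show "?l \<Longrightarrow> ?r" by (intro ballI tp_eqD)
  show ?l if ?r
  proof -
    have "tp k N \<alpha> c A \<subseteq> tp k N \<alpha> c' A"
      if "\<And>\<beta> b \<phi>. \<beta> \<in> Field k \<Longrightarrow> b \<in> tup k \<beta> A \<Longrightarrow> \<phi> \<in> qf k N \<alpha> \<beta> \<Longrightarrow>
        holds k N (case_sum c b) \<phi> \<Longrightarrow> holds k N (case_sum c' b) \<phi>" for c c'
      using that unfolding tp_def by fast
    from this[of c c'] this[of c' c] \<open>?r\<close> show ?l by (simp add: subset_antisym)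
  qed
qed

lemma tp_eq_mono:
  assumes "tp k N \<alpha> c B = tp k N \<alpha> c' B" and "A \<subseteq> B"
  shows "tp k N \<alpha> c A = tp k N \<alpha> c' A"
  unfolding tp_eq_iff
proof (intro ballI)
  fix \<beta> b \<phi> assume "\<beta> \<in> Field k" "b \<in> tup k \<beta> A" "\<phi> \<in> qf k N \<alpha> \<beta>"
  then show "holds k N (case_sum c b) \<phi> \<longleftrightarrow> holds k N (case_sum c' b) \<phi>"
    by (intro tp_eqD[OF assms(1)] subsetD[OF tup_mono[OF assms(2)]])
qed

text \<open>In \<open>qf\<close> the parameters occupy the right-hand variables. Exchanging the two
  sides makes \<open>a\<close> the parameter, so that the type of \<open>b\<close> over
  \<open>A\<close> decides the formula.\<close>

lemma tp_eq_swapD: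
  fixes a b b' :: "'k \<Rightarrow> 'a"
  assumes "tp k N \<beta> b A = tp k N \<beta> b' A"
    and "\<alpha> \<in> Field k" and "a \<in> tup k \<alpha> A" and "\<phi> \<in> qf k N \<alpha> \<beta>"
  shows "holds k N (case_sum a b) \<phi> \<longleftrightarrow> holds k N (case_sum a b') \<phi>"
proof -
  let ?\<psi> = "map_fm (case_sum Inr Inl) \<phi>"
  have "?\<psi> \<in> qf k N \<beta> \<alpha>"
    using assms(4) by (intro map_fm_in_qf[where V = "underS k \<alpha> <+> underS k \<beta>"]) (auto simp: qf_def)
  moreover have "case_sum d a \<circ> case_sum Inr Inl = case_sum a d" for d :: "'k \<Rightarrow> 'a"
    by (auto split: sum.split)
  ultimately show ?thesis
    using tp_eqD[OF assms(1-3), of ?\<psi>] by (simp only: holds_map_fm)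
qed

lemma type_restr_tp:
  assumes "\<alpha> \<in> Field k" and "A \<subseteq> B"
  shows "type_restr k N (tp k N \<alpha> c B) A = tp k N \<alpha> c A"
proof
  show "type_restr k N (tp k N \<alpha> c B) A \<subseteq> tp k N \<alpha> c A"
  proof
    fix \<Phi> assume "\<Phi> \<in> type_restr k N (tp k N \<alpha> c B) A"
    then obtain \<alpha>' \<beta> b \<phi> where *: "\<Phi> = inst b \<phi>" "\<beta> \<in> Field k" "b \<in> tup k \<beta> A" "\<phi> \<in> qf k N \<alpha>' \<beta>"
      and "inst b \<phi> \<in> tp k N \<alpha> c B"
      by (auto simp: type_restr_def)
      with inst_in_tpD[OF this(5) this(4)] show "\<Phi> \<in> tp k N \<alpha> c A"
      by (simp add: inst_in_tp_iff)
  qed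
  show "tp k N \<alpha> c A \<subseteq> type_restr k N (tp k N \<alpha> c B) A"
  proof
    fix \<Phi> assume "\<Phi> \<in> tp k N \<alpha> c A"
    then obtain \<beta> b \<phi> where *: "\<Phi> = inst b \<phi>" "\<beta> \<in> Field k" "b \<in> tup k \<beta> A" "\<phi> \<in> qf k N \<alpha> \<beta>"
      "holds k N (case_sum c b) \<phi>"
      by (auto simp: tp_def)
    then have "\<Phi> \<in> tp k N \<alpha> c B"
      using subsetD[OF tup_mono[OF assms(2)]] unfolding *(1) by (subst inst_in_tp_iff) blast+
    then show "\<Phi> \<in> type_restr k N (tp k N \<alpha> c B) A"
      unfolding type_restr_def using * assms(1) by blast
  qed
qed

lemma saturated_realize:
  assumes "saturated k N l M" and "\<alpha> \<in> Field k" and "A \<subseteq> M" and "|A| <o l" and "c \<in> tup k \<alpha> UNIV"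
  obtains c' where "c' \<in> tup k \<alpha> M" and "tp k N \<alpha> c' A = tp k N \<alpha> c A"
proof -
  have "\<exists>c'\<in>tup k \<alpha> M. tp k N \<alpha> c' A = tp k N \<alpha> c A"
    using assms(1)[unfolded saturated_def saturated_for_def, rule_format, OF assms(2),
        of A "tp k N \<alpha> c A"] assms(3-5) unfolding types_def by blast
  with that show ?thesis by blast
qed

lemma saturated_mono:
  assumes "saturated k N l M" and "l' \<le>o l"
  shows "saturated k N l' M"
  using assms ordLess_ordLeq_trans unfolding saturated_def saturated_for_def by meson

section \<open>Renaming variables into lengths of tuples\<close>

text \<open>Orders arise from concatenated tuples, naturally indexed by a disjoint sum of lengths.
  Renaming the small index set \<open>X\<close> gives tuples of one genuine length; values of
  \<open>a i\<close> outside \<open>X\<close> do not affect the formula.\<close>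

lemma order_property_if_formula:
  assumes k: "Cinfinite k" and X: "|X| <o k" and \<phi>: "wf_fm k N (X <+> X) \<phi>"
    and ord: "\<And>i j. i \<in> Field \<theta> \<Longrightarrow> j \<in> Field \<theta> \<Longrightarrow>
      holds k N (case_sum (a i) (a j)) \<phi> \<longleftrightarrow> (i, j) \<in> \<theta> \<and> i \<noteq> j"
  shows "order_property k N \<theta>"
proof -
  obtain \<gamma> h where \<gamma>: "\<gamma> \<in> Field k" and h: "bij_betw h X (underS k \<gamma>)"
    using ex_bij_betw_underS[OF _ X] k by blast
  define \<psi> where "\<psi> = map_fm (map_sum h h) \<phi>"
  define d where "d i = (\<lambda>x\<in>underS k \<gamma>. a i (inv_into X h x))" for i
  have "\<psi> \<in> qf k N \<gamma> \<gamma>"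
    unfolding \<psi>_def by (rule map_fm_in_qf[OF \<phi>]) (use h in \<open>auto simp: bij_betw_def\<close>)
  moreover have "d i \<in> tup k \<gamma> UNIV" for i
    by (simp add: d_def tup_def)
  moreover have "holds k N (case_sum (d i) (d j)) \<psi> \<longleftrightarrow> holds k N (case_sum (a i) (a j)) \<phi>" for i j
    unfolding \<psi>_def holds_map_fm
  proof (rule holds_cong[OF \<phi>])
    have "d i (h x) = a i x" if "x \<in> X" for i x
      using h that by (auto simp: d_def bij_betw_def)
    then show "(case_sum (d i) (d j) \<circ> map_sum h h) v = case_sum (a i) (a j) v" if "v \<in> X <+> X" for v
      using that by auto
  qed
  ultimately show ?thesis
    unfolding order_property_def using \<gamma> ord
    by (intro bexI[of _ \<gamma>] bexI[of _ \<psi>] exI[of _ d]) simp_all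
qed

lemma finite_card_less_Cinfinite: "Cinfinite k \<Longrightarrow> finite X \<Longrightarrow> |X| <o k"
  using card_of_Card_order by (intro Cfinite_ordLess_Cinfinite) (auto simp: cfinite_def Field_card_of)

lemma ord_one_in_Field:
  assumes k: "Cinfinite k"
  shows "ord_one k \<in> Field k"
proof -
  have wo: "Well_order k"
    using k card_order_on_well_order_on by blast
  have ex: "\<exists>\<alpha>. \<alpha> \<in> Field k \<and> card (underS k \<alpha>) = 1"
  proof -
    obtain \<alpha> h where "\<alpha> \<in> Field k" and "bij_betw h {()} (underS k \<alpha>)"
      using ex_bij_betw_underS[of k "{()}"] k finite_card_less_Cinfinite[OF k] by blast
    then show ?thesis using bij_betw_same_card by fastforce
  qed
  have "\<alpha> = \<beta>" if "\<alpha> \<in> Field k" "card (underS k \<alpha>) = 1" "\<beta> \<in> Field k" "card (underS k \<beta>) = 1" for \<alpha> \<beta>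
  proof (rule ccontr)
    \<comment> \<open>Distinct elements have strictly nested sets of predecessors, so a given finite
      size occurs only once and the definite description in \<open>ord_one\<close> is
      justified.\<close>
    have *: False if "(\<alpha>, \<beta>) \<in> k" "\<alpha> \<noteq> \<beta>" "card (underS k \<alpha>) = 1" "card (underS k \<beta>) = 1" for \<alpha> \<beta>
    proof -
      have "underS k \<alpha> \<subseteq> underS k \<beta>"
        using wo that(1) by (intro underS_incr) (simp_all add: order_on_defs)
      moreover have "\<alpha> \<in> underS k \<beta>" "\<alpha> \<notin> underS k \<alpha>"
        using that(1,2) by (auto simp: underS_def)
      ultimately have "underS k \<alpha> \<subset> underS k \<beta>" by blast
      moreover have "finite (underS k \<beta>)"
        using that(4) by (intro card_ge_0_finite) simp
      ultimately have "card (underS k \<alpha>) < card (underS k \<beta>)" by (rule psubset_card_mono[rotated])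
      then show False using that(3,4) by simp
    qed
    assume "\<alpha> \<noteq> \<beta>"
    then have "(\<alpha>, \<beta>) \<in> k \<or> (\<beta>, \<alpha>) \<in> k"
      using wo that(1,3) unfolding order_on_defs total_on_def by blast
    then show False using *[of \<alpha> \<beta>] *[of \<beta> \<alpha>] \<open>\<alpha> \<noteq> \<beta>\<close> that by auto
  qed
  with ex have "\<exists>!\<alpha>. \<alpha> \<in> Field k \<and> card (underS k \<alpha>) = 1" by (metis (no_types, lifting))
  from theI'[OF this] show ?thesis by (simp add: ord_one_def)
qed

section \<open>Counting formulas\<close>

text \<open>
  The index type may be larger than the cardinal, and irrelevant components of a formula are
  arbitrary, so formulas are counted through the labels along their relevant branches.
  As the cardinal may be singular, the bound is \<open>2\<close> to the power \<open>\<chi>\<^sub>0\<close> rather than \<open>\<chi>\<^sub>0\<close>.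
\<close>

datatype (dead 'f, dead 'r, dead 'k, dead 'v) label =
  LVar 'v | LFn 'f | LEq | LRel 'r | LNeg | LConj 'k

type_synonym ('f, 'r, 'k, 'v) branches = "(('k + bool) list \<times> ('f, 'r, 'k, 'v) label) set"

definition below :: "'k + bool \<Rightarrow> ('f, 'r, 'k, 'v) branches \<Rightarrow> ('f, 'r, 'k, 'v) branches" where
  "below p C = map_prod (Cons p) id ` C"

primrec tm_branches :: "'k rel \<Rightarrow> ('f, 'r, 'k, 'z) lang_scheme \<Rightarrow> ('f, 'k, 'v) tm
    \<Rightarrow> ('f, 'r, 'k, 'v) branches" where
  "tm_branches k L (Var v) = {([], LVar v)}"
| "tm_branches k L (Fn f ts) =
    insert ([], LFn f) (\<Union>i\<in>underS k (fun_arity L f). below (Inl i) (tm_branches k L (ts i)))"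

primrec fm_branches :: "'k rel \<Rightarrow> ('f, 'r, 'k, 'z) lang_scheme \<Rightarrow> ('f, 'r, 'k, 'v) fm
    \<Rightarrow> ('f, 'r, 'k, 'v) branches" where
  "fm_branches k L (Eq s t) =
    insert ([], LEq) (below (Inr True) (tm_branches k L s) \<union> below (Inr False) (tm_branches k L t))"
| "fm_branches k L (Rel R ts) =
    insert ([], LRel R) (\<Union>i\<in>underS k (rel_arity L R). below (Inl i) (tm_branches k L (ts i)))"
| "fm_branches k L (Neg \<phi>) = insert ([], LNeg) (below (Inr True) (fm_branches k L \<phi>))"
| "fm_branches k L (Conj \<alpha> F) =
    insert ([], LConj \<alpha>) (\<Union>i\<in>underS k \<alpha>. below (Inl i) (fm_branches k L (F i)))"

lemma in_below_iff [simp]: "(ps, x) \<in> below p C \<longleftrightarrow> (\<exists>qs. ps = p # qs \<and> (qs, x) \<in> C)"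
  by (force simp: below_def)

lemma branches_root [simp]:
  "([], x) \<in> tm_branches k L (Var v) \<longleftrightarrow> x = LVar v"
  "([], x) \<in> tm_branches k L (Fn f ts) \<longleftrightarrow> x = LFn f"
  "([], x) \<in> fm_branches k L (Eq s t) \<longleftrightarrow> x = LEq"
  "([], x) \<in> fm_branches k L (Rel R ts) \<longleftrightarrow> x = LRel R"
  "([], x) \<in> fm_branches k L (Neg \<phi>) \<longleftrightarrow> x = LNeg"
  "([], x) \<in> fm_branches k L (Conj \<alpha> F) \<longleftrightarrow> x = LConj \<alpha>"
  by auto

lemma branches_below [simp]:
  "(Inl i # qs, x) \<in> tm_branches k L (Fn f ts) \<longleftrightarrow>
    i \<in> underS k (fun_arity L f) \<and> (qs, x) \<in> tm_branches k L (ts i)"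
  "(Inr b # qs, x) \<in> fm_branches k L (Eq s t) \<longleftrightarrow>
    (qs, x) \<in> (if b then tm_branches k L s else tm_branches k L t)"
  "(Inl i # qs, x) \<in> fm_branches k L (Rel R ts) \<longleftrightarrow>
    i \<in> underS k (rel_arity L R) \<and> (qs, x) \<in> tm_branches k L (ts i)"
  "(Inr True # qs, x) \<in> fm_branches k L (Neg \<phi>) \<longleftrightarrow> (qs, x) \<in> fm_branches k L \<phi>"
  "(Inl i # qs, x) \<in> fm_branches k L (Conj \<alpha> F) \<longleftrightarrow>
    i \<in> underS k \<alpha> \<and> (qs, x) \<in> fm_branches k L (F i)"
  by auto

text \<open>The label of the empty path reveals the constructor and its symbol, hence the arity; the
  paths starting with a relevant index then give the branches of that component. Components beyond
  the arity leave no branches and do not influence the value.\<close>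

lemma tm_val_eq_if_branches_eq:
  "tm_branches k N s = tm_branches k N t \<Longrightarrow> tm_val k N e s = tm_val k N e t"
proof (induction s arbitrary: t)
  case (Var v)
  then have "([], LVar v) \<in> tm_branches k N t"
    by (metis branches_root(1))
  then show ?case
    by (cases t) (simp_all del: tm_branches.simps)
next
  case (Fn f ts)
  have root: "([], x) \<in> tm_branches k N (Fn f ts) \<longleftrightarrow> ([], x) \<in> tm_branches k N t" for x
    using Fn.prems by simp
  show ?case
  proof (cases t)
    case t: (Var v)
    from root[of "LFn f"] show ?thesis
      unfolding t branches_root by simp
  next
    case t: (Fn g us)
    have fg: "g = f"
      using root[of "LFn f"] unfolding t branches_root by simp
    have "tm_val k N e (ts i) = tm_val k N e (us i)" if i: "i \<in> underS k (fun_arity N f)" for i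
    proof (rule Fn.IH)
      have "(qs, x) \<in> tm_branches k N (ts i) \<longleftrightarrow> (qs, x) \<in> tm_branches k N (us i)" for qs x
      proof -
        have "(Inl i # qs, x) \<in> tm_branches k N (Fn f ts) \<longleftrightarrow> (Inl i # qs, x) \<in> tm_branches k N (Fn f us)"
          using Fn.prems unfolding t fg by (simp only:)
        then show ?thesis using i unfolding branches_below by blast
      qed
      then show "tm_branches k N (ts i) = tm_branches k N (us i)" by auto
    qed simp
    then show ?thesis
      unfolding t fg tm_val.simps by (intro arg_cong[where f = "fun_int N f"] restrict_ext)
  qed
qed

lemma holds_iff_if_branches_eq:
  "fm_branches k N \<phi> = fm_branches k N \<psi> \<Longrightarrow> holds k N e \<phi> \<longleftrightarrow> holds k N e \<psi>"
proof (induction \<phi> arbitrary: \<psi>)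
  case (Eq s t)
  have mem: "(p, x) \<in> fm_branches k N (Eq s t) \<longleftrightarrow> (p, x) \<in> fm_branches k N \<psi>" for p x
    using Eq by simp
  obtain s' t' where \<psi>: "\<psi> = Eq s' t'"
    using mem[of "[]" LEq] by (cases \<psi>) (auto simp del: fm_branches.simps)
  have "(p, x) \<in> tm_branches k N s \<longleftrightarrow> (p, x) \<in> tm_branches k N s'"
    "(p, x) \<in> tm_branches k N t \<longleftrightarrow> (p, x) \<in> tm_branches k N t'" for p x
    using mem[of "Inr True # p" x] mem[of "Inr False # p" x] unfolding \<psi> branches_below by auto
  then have "tm_branches k N s = tm_branches k N s'" "tm_branches k N t = tm_branches k N t'"
    by auto
  then show ?case
    using tm_val_eq_if_branches_eq[of k N s s' e] tm_val_eq_if_branches_eq[of k N t t' e] by (simp add: \<psi>)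
next
  case (Rel R ts)
  have mem: "(p, x) \<in> fm_branches k N (Rel R ts) \<longleftrightarrow> (p, x) \<in> fm_branches k N \<psi>" for p x
    using Rel by simp
  obtain us where \<psi>: "\<psi> = Rel R us"
    using mem[of "[]" "LRel R"] by (cases \<psi>) (auto simp del: fm_branches.simps)
  have "tm_val k N e (ts i) = tm_val k N e (us i)" if i: "i \<in> underS k (rel_arity N R)" for i
  proof -
    have "(p, x) \<in> tm_branches k N (ts i) \<longleftrightarrow> (p, x) \<in> tm_branches k N (us i)" for p x
      using mem[of "Inl i # p" x] i unfolding \<psi> branches_below by blast
    then have "tm_branches k N (ts i) = tm_branches k N (us i)" by auto
    then show ?thesis by (rule tm_val_eq_if_branches_eq)
  qed
  then show ?case
    unfolding \<psi> holds.simps by (intro arg_cong[where f = "rel_int N R"] restrict_ext)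
next
  case (Neg \<phi>)
  have mem: "(p, x) \<in> fm_branches k N (Neg \<phi>) \<longleftrightarrow> (p, x) \<in> fm_branches k N \<psi>" for p x
    using Neg.prems by simp
  obtain \<psi>' where \<psi>: "\<psi> = Neg \<psi>'"
    using mem[of "[]" LNeg] by (cases \<psi>) (auto simp del: fm_branches.simps)
  have "(p, x) \<in> fm_branches k N \<phi> \<longleftrightarrow> (p, x) \<in> fm_branches k N \<psi>'" for p x
    using mem[of "Inr True # p" x] unfolding \<psi> branches_below by blast
  then have "fm_branches k N \<phi> = fm_branches k N \<psi>'" by auto
  then show ?case using Neg.IH by (simp add: \<psi>)
next
  case (Conj \<alpha> F)
  have mem: "(p, x) \<in> fm_branches k N (Conj \<alpha> F) \<longleftrightarrow> (p, x) \<in> fm_branches k N \<psi>" for p x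
    using Conj.prems by simp
  obtain G where \<psi>: "\<psi> = Conj \<alpha> G"
    using mem[of "[]" "LConj \<alpha>"] by (cases \<psi>) (auto simp del: fm_branches.simps)
  have "holds k N e (F i) \<longleftrightarrow> holds k N e (G i)" if i: "i \<in> underS k \<alpha>" for i
  proof (rule Conj.IH)
    have "(p, x) \<in> fm_branches k N (F i) \<longleftrightarrow> (p, x) \<in> fm_branches k N (G i)" for p x
      using mem[of "Inl i # p" x] i unfolding \<psi> branches_below by blast
    then show "fm_branches k N (F i) = fm_branches k N (G i)" by auto
  qed simp
  then show ?case by (simp add: \<psi>)
qed

definition labels :: "'k rel \<Rightarrow> ('f, 'r, 'k, 'z) lang_scheme \<Rightarrow> 'v set \<Rightarrow> ('f, 'r, 'k, 'v) label set" where
  "labels k L V = LVar ` V \<union> LFn ` Funs L \<union> LRel ` Rels L \<union> LConj ` Field k \<union> {LEq, LNeg}"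

lemma below_subset:
  "C \<subseteq> lists P \<times> X \<Longrightarrow> p \<in> P \<Longrightarrow> below p C \<subseteq> lists P \<times> X"
  by (force simp: below_def)

lemma tm_branches_subset:
  "wf_tm k L V t \<Longrightarrow> tm_branches k L t \<subseteq> lists (Field k <+> UNIV) \<times> labels k L V"
proof (induction t)
  case (Fn f ts)
  then have "below (Inl i) (tm_branches k L (ts i)) \<subseteq> lists (Field k <+> UNIV) \<times> labels k L V"
    if "i \<in> underS k (fun_arity L f)" for i
    using that subsetD[OF underS_subset_Field that] by (intro below_subset) auto
  then show ?case
    using Fn.prems unfolding tm_branches.simps by (intro insert_subsetI UN_least) (auto simp: labels_def)
qed (auto simp: labels_def)

lemma fm_branches_subset:
  "wf_fm k L V \<phi> \<Longrightarrow> fm_branches k L \<phi> \<subseteq> lists (Field k <+> UNIV) \<times> labels k L V"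
proof (induction \<phi>)
  case (Eq s t)
  then show ?case
    unfolding fm_branches.simps
    by (intro insert_subsetI Un_least below_subset tm_branches_subset) (auto simp: labels_def)
next
  case (Rel R ts)
  then have "below (Inl i) (tm_branches k L (ts i)) \<subseteq> lists (Field k <+> UNIV) \<times> labels k L V"
    if "i \<in> underS k (rel_arity L R)" for i
    using that subsetD[OF underS_subset_Field that] by (intro below_subset tm_branches_subset) auto
  then show ?case
    using Rel.prems unfolding fm_branches.simps by (intro insert_subsetI UN_least) (auto simp: labels_def)
next
  case (Neg \<phi>)
  then show ?case
    unfolding fm_branches.simps by (intro insert_subsetI below_subset) (auto simp: labels_def)
next
  case (Conj \<alpha> F)
  then have "below (Inl i) (fm_branches k L (F i)) \<subseteq> lists (Field k <+> UNIV) \<times> labels k L V"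
    if "i \<in> underS k \<alpha>" for i
    using that subsetD[OF underS_subset_Field that] by (intro below_subset) auto
  then show ?case
    using Conj.prems unfolding fm_branches.simps by (intro insert_subsetI UN_least) (auto simp: labels_def)
qed

lemma lang_pow_ge:
  assumes k: "Cinfinite k"
  shows "|Field k| \<le>o lang_pow k L" and "|Funs L| \<le>o lang_pow k L" and "|Rels L| \<le>o lang_pow k L"
proof -
  have const: "(\<lambda>_\<in>underS k \<alpha>. z) \<in> tup k \<alpha> Z" if "z \<in> Z" for \<alpha> z and Z :: "'z set"
    using that by (simp add: tup_def)
  \<comment> \<open>Symbols are coded by constant sequences of length one. Length zero would lose
    the symbol, as there is only one empty sequence.\<close>
  obtain \<gamma> h where \<gamma>: "\<gamma> \<in> Field k" and h: "bij_betw h {()} (underS k \<gamma>)"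
    using ex_bij_betw_underS[of k "{()}"] k finite_card_less_Cinfinite[OF k] by blast
  then have \<gamma>_ne: "h () \<in> underS k \<gamma>"
    by (auto simp: bij_betw_def)
  have inj: "inj_on (\<lambda>z. (\<gamma>, \<lambda>_\<in>underS k \<gamma>. g z)) A" if "inj_on g A" for g and A :: "'y set"
  proof (rule inj_onI)
    fix x y assume *: "x \<in> A" "y \<in> A" "(\<gamma>, \<lambda>_\<in>underS k \<gamma>. g x) = (\<gamma>, \<lambda>_\<in>underS k \<gamma>. g y)"
    then have "(\<lambda>_\<in>underS k \<gamma>. g x) (h ()) = (\<lambda>_\<in>underS k \<gamma>. g y) (h ())"
      by simp
    then show "x = y" using \<gamma>_ne * that by (simp add: inj_on_def)
  qed
  show "|Field k| \<le>o lang_pow k L"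
    unfolding lang_pow_def
    by (rule card_of_ordLeqI[where f = "\<lambda>\<alpha>. (\<alpha>, \<lambda>_\<in>underS k \<alpha>. Inr True)"])
      (auto simp: inj_on_def intro!: const)
  show "|Funs L| \<le>o lang_pow k L"
    unfolding lang_pow_def
    by (rule card_of_ordLeqI[OF inj[of "\<lambda>f. Inl (Inl f)"]])
      (auto simp: inj_on_def \<gamma> intro!: const)
  show "|Rels L| \<le>o lang_pow k L"
    unfolding lang_pow_def
    by (rule card_of_ordLeqI[OF inj[of "\<lambda>R. Inl (Inr R)"]])
      (auto simp: inj_on_def \<gamma> intro!: const)
qed

lemma Cinfinite_if_lang_pow_le:
  assumes "Cinfinite k" and "Card_order r" and "lang_pow k L \<le>o r"
  shows "Cinfinite r" and "k \<le>o r"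
proof -
  show kr: "k \<le>o r"
    using assms lang_pow_ge(1) card_of_Field_ordIso ordIso_symmetric ordIso_ordLeq_trans ordLeq_transitive
    by metis
  show "Cinfinite r"
    using cinfinite_mono[OF kr] assms by blast
qed

text \<open>Paths are finite and there are at most \<open>r\<close> edges and labels, so a formula
  is coded by a subset of a set of size at most \<open>r\<close>. The union over all \<beta> lets
  one count serve formulas with parameter tuples of any length.\<close>

lemma card_of_fm_branches:
  assumes k: "Cinfinite k" and r: "Card_order r" "lang_pow k L \<le>o r"
  shows "|fm_branches k L ` (\<Union>\<beta>\<in>Field k. qf k L \<alpha> \<beta>)| \<le>o ctwo ^c r"
proof -
  note R = Cinfinite_if_lang_pow_le(1)[OF k r]
  note le = ordLeq_transitive[OF lang_pow_ge(1)[OF k, of L] r(2)]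
    ordLeq_transitive[OF lang_pow_ge(2)[OF k] r(2)] ordLeq_transitive[OF lang_pow_ge(3)[OF k] r(2)]
  have fin: "|X| \<le>o r" if "finite X" for X :: "'x set"
    using finite_card_less_Cinfinite[OF R that] ordLess_imp_ordLeq by blast
  have img: "|f ` X| \<le>o r" if "|X| \<le>o r" for f :: "'x \<Rightarrow> 'y" and X
    using ordLeq_transitive[OF card_of_image that] .
  have "|Field k <+> (UNIV :: bool set)| \<le>o r"
    using R le(1) fin[of "UNIV :: bool set"] by (simp add: card_of_Plus_ordLeq_infinite_Field cinfinite_def)
  then have "|lists (Field k <+> (UNIV :: bool set))| \<le>o r"
    by (rule card_of_lists[OF R])
  moreover have "|Field k <+> Field k| \<le>o r"
    using R le(1) by (simp add: card_of_Plus_ordLeq_infinite_Field cinfinite_def)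
  then have "|labels k L (Field k <+> Field k)| \<le>o r"
    unfolding labels_def using ordLess_imp_ordLeq[OF finite_card_less_Cinfinite[OF R, of "{LEq, LNeg}"]]
    by (intro Un_Cinfinite_bound R img le) simp_all
  ultimately have *: "|lists (Field k <+> (UNIV :: bool set)) \<times> labels k L (Field k <+> Field k)| \<le>o r"
    using R by (simp add: card_of_Times_ordLeq_infinite_Field cinfinite_def)
  have "fm_branches k L ` (\<Union>\<beta>\<in>Field k. qf k L \<alpha> \<beta>) \<subseteq>
      Pow (lists (Field k <+> (UNIV :: bool set)) \<times> labels k L (Field k <+> Field k))"
  proof clarify
    fix \<beta> \<phi> p x assume "\<phi> \<in> qf k L \<alpha> \<beta>" and x: "(p, x) \<in> fm_branches k L \<phi>"
    then have "wf_fm k L (Field k <+> Field k) \<phi>"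
      using underS_subset_Field unfolding qf_def by (fastforce elim!: wf_fm_mono)
    from subsetD[OF fm_branches_subset[OF this] x]
    show "p \<in> lists (Field k <+> UNIV) \<and> x \<in> labels k L (Field k <+> Field k)" by simp
  qed
  then show ?thesis
    by (rule ordLeq_transitive[OF card_of_mono1 card_of_Pow_ordLeq[OF r(1) *]])
qed

section \<open>Nonsplitting and convergence\<close>

lemma ex_conj_formula:
  assumes k: "Cinfinite k" and "wf_fm k N V \<phi>" and "wf_fm k N V \<psi>"
  obtains \<chi> where "wf_fm k N V \<chi>" and "\<And>e. holds k N e \<chi> \<longleftrightarrow> holds k N e \<phi> \<and> holds k N e \<psi>"
proof -
  \<comment> \<open>Conjunctions are indexed by lengths; \<gamma> is the length two, reached through
    \<open>bool\<close>.\<close>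
  obtain \<gamma> h where \<gamma>: "\<gamma> \<in> Field k" and h: "bij_betw h (UNIV :: bool set) (underS k \<gamma>)"
    using ex_bij_betw_underS[OF conjunct2[OF k] finite_card_less_Cinfinite[OF k finite_UNIV]] by blast
  have h': "h True \<in> underS k \<gamma>" "h False \<in> underS k \<gamma>" "h False \<noteq> h True"
    using h by (auto simp: bij_betw_def inj_on_def)
  let ?\<chi> = "Conj \<gamma> (\<lambda>i. if i = h True then \<phi> else \<psi>)"
  have "holds k N e ?\<chi> \<longleftrightarrow> holds k N e \<phi> \<and> holds k N e \<psi>" for e
  proof
    assume "holds k N e ?\<chi>"
    then have *: "holds k N e (if i = h True then \<phi> else \<psi>)" if "i \<in> underS k \<gamma>" for i
      using that by simp
    show "holds k N e \<phi> \<and> holds k N e \<psi>"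
      using *[OF h'(1)] *[OF h'(2)] h'(3) by simp
  qed simp
  with assms \<gamma> show ?thesis by (intro that[of ?\<chi>]) auto
qed

text \<open>Built as the conjunction of the negations of the two ways to disagree. It expresses that
  a pair of parameter tuples is not separated, which is the relation ordering the sequence in
  \<open>ex_nonsplitting_base\<close>.\<close>

lemma ex_iff_formula:
  assumes k: "Cinfinite k" and \<phi>: "wf_fm k N V \<phi>" and \<psi>: "wf_fm k N V \<psi>"
  obtains \<chi> where "wf_fm k N V \<chi>" and "\<And>e. holds k N e \<chi> \<longleftrightarrow> (holds k N e \<phi> \<longleftrightarrow> holds k N e \<psi>)"
proof -
  have n: "wf_fm k N V (Neg \<phi>)" "wf_fm k N V (Neg \<psi>)" using assms by auto
  obtain \<chi>\<^sub>1 where 1: "wf_fm k N V \<chi>\<^sub>1" "\<And>e. holds k N e \<chi>\<^sub>1 \<longleftrightarrow> holds k N e \<phi> \<and> holds k N e (Neg \<psi>)"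
    using ex_conj_formula[OF k \<phi> n(2)] by metis
  obtain \<chi>\<^sub>2 where 2: "wf_fm k N V \<chi>\<^sub>2" "\<And>e. holds k N e \<chi>\<^sub>2 \<longleftrightarrow> holds k N e (Neg \<phi>) \<and> holds k N e \<psi>"
    using ex_conj_formula[OF k n(1) \<psi>] by metis
  obtain \<chi> where \<chi>: "wf_fm k N V \<chi>" "\<And>e. holds k N e \<chi> \<longleftrightarrow> holds k N e (Neg \<chi>\<^sub>1) \<and> holds k N e (Neg \<chi>\<^sub>2)"
    using ex_conj_formula[OF k, of N V "Neg \<chi>\<^sub>1" "Neg \<chi>\<^sub>2"] 1(1) 2(1) by (metis wf_fm.simps(3))
  show ?thesis
    by (rule that[OF \<chi>(1)]) (auto simp: \<chi>(2) 1(2) 2(2))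
qed

text \<open>Stated through truth values at a realization c instead of membership in its type over
  \<open>M\<close>, which avoids decomposing instances. The relation is symmetric in
  \<open>b\<close> and \<open>b'\<close>, so negations need no separate mention.\<close>

definition nonsplitting :: "'k rel \<Rightarrow> ('f, 'r, 'k, 'a, 'z) struct_scheme \<Rightarrow> 'k \<Rightarrow> ('k \<Rightarrow> 'a) \<Rightarrow> 'a set
    \<Rightarrow> 'a set \<Rightarrow> bool" where
  "nonsplitting k N \<alpha> c M A \<longleftrightarrow>
    (\<forall>\<beta>\<in>Field k. \<forall>\<phi>\<in>qf k N \<alpha> \<beta>. \<forall>b\<in>tup k \<beta> M. \<forall>b'\<in>tup k \<beta> M. tp k N \<beta> b A = tp k N \<beta> b' A \<longrightarrow>
      (holds k N (case_sum c b) \<phi> \<longleftrightarrow> holds k N (case_sum c b') \<phi>))"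

lemma nonsplittingD:
  assumes "nonsplitting k N \<alpha> c M A" and "\<beta> \<in> Field k" and "\<phi> \<in> qf k N \<alpha> \<beta>"
    and "b \<in> tup k \<beta> M" and "b' \<in> tup k \<beta> M" and "tp k N \<beta> b A = tp k N \<beta> b' A"
  shows "holds k N (case_sum c b) \<phi> \<longleftrightarrow> holds k N (case_sum c b') \<phi>"
  using assms unfolding nonsplitting_def by (metis (no_types))

lemma nonsplitting_mono:
  assumes "nonsplitting k N \<alpha> c M A" and "A \<subseteq> A'"
  shows "nonsplitting k N \<alpha> c M A'"
  unfolding nonsplitting_def
proof (intro ballI impI)
  fix \<beta> \<phi> b b'
  assume "\<beta> \<in> Field k" "\<phi> \<in> qf k N \<alpha> \<beta>" "b \<in> tup k \<beta> M" "b' \<in> tup k \<beta> M"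
    and "tp k N \<beta> b A' = tp k N \<beta> b' A'"
  then show "holds k N (case_sum c b) \<phi> \<longleftrightarrow> holds k N (case_sum c b') \<phi>"
    using nonsplittingD[OF assms(1)] tp_eq_mono[OF _ assms(2)] by metis
qed

lemma card_of_tup_range:
  assumes "Cinfinite k" and "k \<le>o r" and "\<alpha> \<in> Field k"
  shows "|c ` underS k \<alpha>| \<le>o r"
proof -
  have "|underS k \<alpha>| <o k"
    using assms by (simp add: card_of_underS)
  then have "|underS k \<alpha>| \<le>o r"
    using assms(2) ordLess_imp_ordLeq ordLeq_transitive by blast
  then show ?thesis by (rule ordLeq_transitive[OF card_of_image])
qed

lemma Cinfinite_ctwo_cexp: "Cinfinite r \<Longrightarrow> Cinfinite (ctwo ^c r)"
  by (simp add: Cinfinite_cexp ordLeq_refl Card_order_ctwo)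

lemma ordLeq_ctwo_cexp: "Card_order r \<Longrightarrow> r \<le>o ctwo ^c r"
  using ordLess_ctwo_cexp ordLess_imp_ordLeq by blast

text \<open>Suppose the type splits over every small subset of \<open>M\<close>. By recursion, take
  a pair b, b' in \<open>M\<close> with equal types over the realizations found so far which c
  separates by a formula, and then a realization in \<open>M\<close> of the type of c over all pairs
  taken up to this stage. A realization found before a pair cannot separate it; one found at its
  stage or later separates it as c does. There are (2^\<chi>)^+ stages and at most 2^\<chi> formulas
  up to irrelevant components, so one formula serves \<chi>^+ stages, and its failure to separate
  defines their order.\<close>

lemma ex_nonsplitting_base:
  fixes \<chi> :: "'c rel" and k :: "'k rel" and N :: "('f, 'r, 'k, 'a, 'z) struct_scheme"
  assumes k: "Cinfinite k" and \<chi>: "Card_order \<chi>" "lang_pow k N \<le>o \<chi>"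
    and no_op: "\<not> order_property k N (cardSuc \<chi>)"
    and sat: "saturated k N (cardSuc (ctwo ^c \<chi>)) M"
    and \<alpha>: "\<alpha> \<in> Field k" and c: "c \<in> tup k \<alpha> UNIV"
  obtains A where "A \<subseteq> M" and "|A| \<le>o ctwo ^c \<chi>" and "nonsplitting k N \<alpha> c M A"
proof (rule ccontr)
  assume "\<not> thesis"
  let ?X = "ctwo ^c \<chi>"
  let ?\<Theta> = "cardSuc ?X"
  have \<chi>_inf: "Cinfinite \<chi>" and k\<chi>: "k \<le>o \<chi>"
    using Cinfinite_if_lang_pow_le[OF k \<chi>] by auto
  have X: "Cinfinite ?X" "\<chi> \<le>o ?X"
    using \<chi>_inf by (auto simp: Cinfinite_ctwo_cexp ordLeq_ctwo_cexp)
  have kX: "k \<le>o ?X"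
    using k\<chi> X(2) ordLeq_transitive by blast
  have \<Theta>: "Card_order ?\<Theta>" "Well_order ?\<Theta>"
    using X(1) by (auto intro: cardSuc_Card_order cardSuc_Well_order)
  \<comment> \<open>The pair is oriented so that c satisfies the formula at \<open>b\<close> only;
    exchanging the two tuples achieves this.\<close>
  define Q where "Q A \<beta> \<phi> b b' \<longleftrightarrow> \<beta> \<in> Field k \<and> \<phi> \<in> qf k N \<alpha> \<beta> \<and> b \<in> tup k \<beta> M \<and> b' \<in> tup k \<beta> M \<and>
      tp k N \<beta> b A = tp k N \<beta> b' A \<and> holds k N (case_sum c b) \<phi> \<and> \<not> holds k N (case_sum c b') \<phi>"
    for A \<beta> \<phi> b b'
  have ex: "\<exists>\<beta> \<phi> b b'. A \<subseteq> M \<and> |A| \<le>o ?X \<longrightarrow> Q A \<beta> \<phi> b b'" for A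
  proof (cases "A \<subseteq> M \<and> |A| \<le>o ?X")
    case True
    then have "\<not> nonsplitting k N \<alpha> c M A"
      using \<open>\<not> thesis\<close> that by blast
    then obtain \<beta> \<phi> b b' where *: "\<beta> \<in> Field k" "\<phi> \<in> qf k N \<alpha> \<beta>" "b \<in> tup k \<beta> M" "b' \<in> tup k \<beta> M"
      "tp k N \<beta> b A = tp k N \<beta> b' A"
      and ne: "holds k N (case_sum c b) \<phi> \<noteq> holds k N (case_sum c b') \<phi>"
      unfolding nonsplitting_def by blast
    show ?thesis
    proof (cases "holds k N (case_sum c b) \<phi>")
      case True
      then have "Q A \<beta> \<phi> b b'" using * ne by (simp add: Q_def)
      then show ?thesis by blast
    next
      case False
      then have "Q A \<beta> \<phi> b' b" using * ne by (simp add: Q_def)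
      then show ?thesis by blast
    qed
  qed blast
  obtain \<beta> \<phi> b b' where Q: "\<And>A. A \<subseteq> M \<Longrightarrow> |A| \<le>o ?X \<Longrightarrow> Q A (\<beta> A) (\<phi> A) (b A) (b' A)"
    using ex by metis
  \<comment> \<open>The witnesses of splitting depend on the set alone. The recursion thus records
    only the realizations \<open>f\<close>, and the earlier pairs are recomputed from them.\<close>
  define D where "D f \<xi> = (\<Union>\<eta>\<in>underS ?\<Theta> \<xi>. f \<eta> ` underS k \<alpha>)" for f :: "('c \<Rightarrow> bool) set \<Rightarrow> 'k \<Rightarrow> 'a" and \<xi>
  define W where "W A = b A ` underS k (\<beta> A) \<union> b' A ` underS k (\<beta> A)" for A
  \<comment> \<open>The pair of stage \<xi> itself is included, so that the diagonal case i = j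
    falls on the same side as i > j and the order obtained is strict.\<close>
  define E where "E f \<xi> = W (D f \<xi>) \<union> (\<Union>\<eta>\<in>underS ?\<Theta> \<xi>. W (D f \<eta>))" for f \<xi>
  define P where "P f \<xi> r \<longleftrightarrow> r \<in> tup k \<alpha> M \<and> tp k N \<alpha> r (E f \<xi>) = tp k N \<alpha> c (E f \<xi>)" for f \<xi> r
  have D: "D f \<xi> \<subseteq> M" "|D f \<xi>| \<le>o ?X" if "\<And>\<eta>. \<eta> \<in> underS ?\<Theta> \<xi> \<Longrightarrow> f \<eta> \<in> tup k \<alpha> M" for f \<xi>
  proof -
    show "D f \<xi> \<subseteq> M"
      using that unfolding D_def tup_range_iff[of _ _ _ M] by blast
    show "|D f \<xi>| \<le>o ?X"
      unfolding D_def by (rule card_of_UNION_underS[OF X(1) card_of_tup_range[OF k kX \<alpha>]])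
  qed
  have W: "W A \<subseteq> M" "|W A| \<le>o ?X" if "A \<subseteq> M" "|A| \<le>o ?X" for A
  proof -
    have q: "\<beta> A \<in> Field k" "b A \<in> tup k (\<beta> A) M" "b' A \<in> tup k (\<beta> A) M"
      using Q[OF that] by (auto simp: Q_def)
    show "W A \<subseteq> M"
      using q(2,3) unfolding W_def tup_range_iff[of _ _ _ M] by blast
    show "|W A| \<le>o ?X"
      unfolding W_def by (intro Un_Cinfinite_bound X(1) card_of_tup_range[OF k kX q(1)])
  qed
  have trans: "underS ?\<Theta> \<eta> \<subseteq> underS ?\<Theta> \<xi>" if "\<eta> \<in> underS ?\<Theta> \<xi>" for \<eta> \<xi>
    using \<Theta>(2) that by (intro underS_incr) (auto simp: order_on_defs underS_def)
  have "\<exists>f. \<forall>\<xi>. P f \<xi> (f \<xi>)"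
  proof (rule dependent_wf_choice[OF wf_minus_Id[OF \<Theta>(2)]])
    fix f g :: "('c \<Rightarrow> bool) set \<Rightarrow> 'k \<Rightarrow> 'a" and \<xi> r
    assume "\<And>\<eta>. (\<eta>, \<xi>) \<in> ?\<Theta> - Id \<Longrightarrow> f \<eta> = g \<eta>"
    then have eq: "f \<eta> = g \<eta>" if "\<eta> \<in> underS ?\<Theta> \<xi>" for \<eta>
      using that by (auto simp: underS_def)
    have "D f \<xi> = D g \<xi>"
      unfolding D_def using eq by simp
    moreover have "D f \<eta> = D g \<eta>" if "\<eta> \<in> underS ?\<Theta> \<xi>" for \<eta>
      unfolding D_def using eq subsetD[OF trans[OF that]] by simp
    ultimately have "E f \<xi> = E g \<xi>"
      unfolding E_def by simp
    then show "P f \<xi> r = P g \<xi> r"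
      unfolding P_def by simp
  next
    fix \<xi> f
    assume "\<And>\<eta>. (\<eta>, \<xi>) \<in> ?\<Theta> - Id \<Longrightarrow> P f \<eta> (f \<eta>)"
    then have f: "f \<eta> \<in> tup k \<alpha> M" if "\<eta> \<in> underS ?\<Theta> \<xi>" for \<eta>
      using that by (auto simp: P_def underS_def)
    have Wf: "W (D f \<eta>) \<subseteq> M \<and> |W (D f \<eta>)| \<le>o ?X" if "\<eta> \<in> insert \<xi> (underS ?\<Theta> \<xi>)" for \<eta>
    proof -
      have "f \<zeta> \<in> tup k \<alpha> M" if "\<zeta> \<in> underS ?\<Theta> \<eta>" for \<zeta>
        using f that trans \<open>\<eta> \<in> _\<close> by blast
      then show ?thesis using D W by simp
    qed
    have EM: "E f \<xi> \<subseteq> M"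
      unfolding E_def using Wf by blast
    have "|E f \<xi>| \<le>o ?X"
      unfolding E_def using Wf by (intro Un_Cinfinite_bound card_of_UNION_underS X(1)) auto
    then have "|E f \<xi>| <o ?\<Theta>"
      using X(1) cardSuc_ordLeq_ordLess[of ?X "|E f \<xi>|"] by (simp add: card_of_Card_order)
    then show "\<exists>r. P f \<xi> r"
      using saturated_realize[OF sat \<alpha> EM _ c] unfolding P_def by metis
  qed
  then obtain f where f: "\<And>\<xi>. P f \<xi> (f \<xi>)" by blast
  define A where "A = D f"
  have fM: "f \<xi> \<in> tup k \<alpha> M" for \<xi>
    using f by (simp add: P_def)
  have QA: "Q (A \<xi>) (\<beta> (A \<xi>)) (\<phi> (A \<xi>)) (b (A \<xi>)) (b' (A \<xi>))" for \<xi>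
    unfolding A_def using D fM by (intro Q) auto
  have real: "tp k N \<alpha> (f \<xi>) (E f \<xi>) = tp k N \<alpha> c (E f \<xi>)" for \<xi>
    using f by (simp add: P_def)
  have below: "f \<eta> \<in> tup k \<alpha> (A \<xi>)" if "\<eta> \<in> underS ?\<Theta> \<xi>" for \<eta> \<xi>
    using fM[of \<eta>] that unfolding tup_range_iff[of _ _ _ "A \<xi>"] tup_range_iff[of _ _ _ M]
    by (auto simp: A_def D_def)
  have above: "b (A \<eta>) \<in> tup k (\<beta> (A \<eta>)) (E f \<xi>) \<and> b' (A \<eta>) \<in> tup k (\<beta> (A \<eta>)) (E f \<xi>)"
    if "\<eta> = \<xi> \<or> \<eta> \<in> underS ?\<Theta> \<xi>" for \<eta> \<xi>
  proof -
    have "W (A \<eta>) \<subseteq> E f \<xi>"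
      using that by (auto simp: E_def A_def)
    moreover have "b (A \<eta>) \<in> tup k (\<beta> (A \<eta>)) M" "b' (A \<eta>) \<in> tup k (\<beta> (A \<eta>)) M"
      using QA[of \<eta>] by (auto simp: Q_def)
    ultimately show ?thesis
      unfolding tup_range_iff[of _ _ _ "E f \<xi>"] tup_range_iff[of _ _ _ M] W_def by blast
  qed
  \<comment> \<open>The colour uses branches in place of the formula, since formulas differing only
    in irrelevant components may be too numerous.\<close>
  define F where "F \<xi> = (\<beta> (A \<xi>), fm_branches k N (\<phi> (A \<xi>)))" for \<xi>
  have "F ` Field ?\<Theta> \<subseteq> Field k \<times> fm_branches k N ` (\<Union>\<beta>\<in>Field k. qf k N \<alpha> \<beta>)"
    using QA by (auto simp: F_def Q_def)
  moreover have "|Field k| \<le>o ?X"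
    by (rule ordLeq_transitive[OF ordLeq_transitive[OF lang_pow_ge(1)[OF k] \<chi>(2)] X(2)])
  then have "|Field k \<times> fm_branches k N ` (\<Union>\<beta>\<in>Field k. qf k N \<alpha> \<beta>)| \<le>o ?X"
    using card_of_fm_branches[OF k \<chi>, of \<alpha>] X(1)
    by (intro card_of_Times_ordLeq_infinite_Field) (auto simp: cinfinite_def)
  ultimately obtain y where y: "cardSuc \<chi> \<le>o |{\<xi> \<in> Field ?\<Theta>. F \<xi> = y}|"
    using pigeonhole_cardinal[OF X(1) \<chi>(1) X(2), of F] by blast
  obtain g where g: "\<And>i. i \<in> Field (cardSuc \<chi>) \<Longrightarrow> g i \<in> {\<xi> \<in> Field ?\<Theta>. F \<xi> = y}"
    and g_mono: "\<And>i j. i \<in> Field (cardSuc \<chi>) \<Longrightarrow> j \<in> Field (cardSuc \<chi>) \<Longrightarrow> i \<noteq> j \<Longrightarrow>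
      (i, j) \<in> cardSuc \<chi> \<Longrightarrow> g i \<in> underS ?\<Theta> (g j)"
    using ex_strict_mono_into_subset[OF cardSuc_Well_order[OF \<chi>(1)] \<Theta>(2) _ y] by blast
  obtain i\<^sub>0 where i\<^sub>0: "i\<^sub>0 \<in> Field (cardSuc \<chi>)"
    using Field_cardSuc_not_empty[OF \<chi>(1)] by blast
  define \<beta>\<^sub>0 where "\<beta>\<^sub>0 = \<beta> (A (g i\<^sub>0))"
  define \<phi>\<^sub>0 where "\<phi>\<^sub>0 = \<phi> (A (g i\<^sub>0))"
  have \<beta>\<^sub>0: "\<beta>\<^sub>0 \<in> Field k" "\<phi>\<^sub>0 \<in> qf k N \<alpha> \<beta>\<^sub>0"
    using QA[of "g i\<^sub>0"] by (auto simp: Q_def \<beta>\<^sub>0_def \<phi>\<^sub>0_def)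
  have F_eq: "\<beta> (A (g i)) = \<beta>\<^sub>0" "\<And>e. holds k N e (\<phi> (A (g i))) \<longleftrightarrow> holds k N e \<phi>\<^sub>0"
    if "i \<in> Field (cardSuc \<chi>)" for i
  proof -
    have "F (g i) = F (g i\<^sub>0)" using g[OF that] g[OF i\<^sub>0] by simp
    then have *: "\<beta> (A (g i)) = \<beta>\<^sub>0" "fm_branches k N (\<phi> (A (g i))) = fm_branches k N \<phi>\<^sub>0"
      by (auto simp: F_def \<beta>\<^sub>0_def \<phi>\<^sub>0_def)
    show "\<beta> (A (g i)) = \<beta>\<^sub>0" by (rule *(1))
    show "holds k N e (\<phi> (A (g i))) \<longleftrightarrow> holds k N e \<phi>\<^sub>0" for e
      by (rule holds_iff_if_branches_eq[OF *(2)])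
  qed
  define c' where "c' i = f (g i)" for i
  define d where "d i = b (A (g i))" for i
  define d' where "d' i = b' (A (g i))" for i
  have lt: "holds k N (case_sum (c' i) (d j)) \<phi>\<^sub>0 \<longleftrightarrow> holds k N (case_sum (c' i) (d' j)) \<phi>\<^sub>0"
    if i: "i \<in> Field (cardSuc \<chi>)" and j: "j \<in> Field (cardSuc \<chi>)" and "i \<noteq> j" "(i, j) \<in> cardSuc \<chi>" for i j
  proof (rule tp_eq_swapD[OF _ \<alpha>])
    show "tp k N \<beta>\<^sub>0 (d j) (A (g j)) = tp k N \<beta>\<^sub>0 (d' j) (A (g j))"
      using QA[of "g j"] F_eq(1)[OF j] by (simp add: Q_def d_def d'_def)
    show "c' i \<in> tup k \<alpha> (A (g j))"
      unfolding c'_def using g_mono[OF that] by (rule below)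
    show "\<phi>\<^sub>0 \<in> qf k N \<alpha> \<beta>\<^sub>0" by (rule \<beta>\<^sub>0)
  qed
  have ge: "holds k N (case_sum (c' i) (d j)) \<phi>\<^sub>0 \<and> \<not> holds k N (case_sum (c' i) (d' j)) \<phi>\<^sub>0"
    if i: "i \<in> Field (cardSuc \<chi>)" and j: "j \<in> Field (cardSuc \<chi>)" and "i = j \<or> (i, j) \<notin> cardSuc \<chi>" for i j
  proof -
    have "j = i \<or> (j, i) \<in> cardSuc \<chi> \<and> j \<noteq> i"
      using that cardSuc_Well_order[OF \<chi>(1)] unfolding order_on_defs total_on_def by blast
    then have "g j = g i \<or> g j \<in> underS ?\<Theta> (g i)"
      using g_mono[OF j i] by blast
    from above[OF this]
    have "d j \<in> tup k \<beta>\<^sub>0 (E f (g i))" "d' j \<in> tup k \<beta>\<^sub>0 (E f (g i))"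
      using F_eq(1)[OF j] by (auto simp: d_def d'_def)
    then have "holds k N (case_sum (c' i) (d j)) \<phi>\<^sub>0 \<longleftrightarrow> holds k N (case_sum c (d j)) \<phi>\<^sub>0"
      "holds k N (case_sum (c' i) (d' j)) \<phi>\<^sub>0 \<longleftrightarrow> holds k N (case_sum c (d' j)) \<phi>\<^sub>0"
      unfolding c'_def using tp_eqD[OF real \<beta>\<^sub>0(1) _ \<beta>\<^sub>0(2)] by blast+
    moreover have "holds k N (case_sum c (d j)) \<phi>\<^sub>0" "\<not> holds k N (case_sum c (d' j)) \<phi>\<^sub>0"
      using QA[of "g j"] F_eq(2)[OF j] by (auto simp: Q_def d_def d'_def)
    ultimately show ?thesis by blast
  qed
  \<comment> \<open>One tuple of the order carries a realization and a pair; the formula reads the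
    realization on its left and the pair on its right.\<close>
  define Y where "Y = underS k \<alpha> <+> (underS k \<beta>\<^sub>0 <+> underS k \<beta>\<^sub>0)"
  have wf0: "wf_fm k N (underS k \<alpha> <+> underS k \<beta>\<^sub>0) \<phi>\<^sub>0"
    using \<beta>\<^sub>0(2) by (simp add: qf_def)
  have wf1: "wf_fm k N (Y <+> Y) (map_fm (map_sum Inl (\<lambda>x. Inr (Inl x))) \<phi>\<^sub>0)"
    and wf2: "wf_fm k N (Y <+> Y) (map_fm (map_sum Inl (\<lambda>x. Inr (Inr x))) \<phi>\<^sub>0)"
    unfolding wf_fm_map_fm by (rule wf_fm_mono[OF wf0], auto simp: Y_def)+
  obtain \<psi> where \<psi>: "wf_fm k N (Y <+> Y) \<psi>"
    and h\<psi>: "\<And>e. holds k N e \<psi> \<longleftrightarrow> (holds k N e (map_fm (map_sum Inl (\<lambda>x. Inr (Inl x))) \<phi>\<^sub>0)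
      \<longleftrightarrow> holds k N e (map_fm (map_sum Inl (\<lambda>x. Inr (Inr x))) \<phi>\<^sub>0))"
    using ex_iff_formula[OF k wf1 wf2] by blast
  have "|underS k \<alpha>| <o k" "|underS k \<beta>\<^sub>0| <o k"
    using k \<alpha> \<beta>\<^sub>0(1) by (auto intro: card_of_underS)
  then have Yk: "|Y| <o k"
    unfolding Y_def using k
    by (intro card_of_Plus_ordLess_infinite_Field) (auto simp: cinfinite_def)
  define t where "t i = case_sum (c' i) (case_sum (d i) (d' i))" for i
  have "order_property k N (cardSuc \<chi>)"
  proof (rule order_property_if_formula[OF k Yk \<psi>, of _ t])
    fix i j assume i: "i \<in> Field (cardSuc \<chi>)" and j: "j \<in> Field (cardSuc \<chi>)"
    have o: "case_sum (t i) (t j) \<circ> map_sum Inl (\<lambda>x. Inr (Inl x)) = case_sum (c' i) (d j)"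
      "case_sum (t i) (t j) \<circ> map_sum Inl (\<lambda>x. Inr (Inr x)) = case_sum (c' i) (d' j)"
      by (auto simp: t_def split: sum.split)
    show "holds k N (case_sum (t i) (t j)) \<psi> \<longleftrightarrow> (i, j) \<in> cardSuc \<chi> \<and> i \<noteq> j"
      unfolding h\<psi> holds_map_fm o using lt[OF i j] ge[OF i j] by blast
  qed
  with no_op show False by blast
qed

text \<open>
  A tuple \<open>b\<close> disagreeing with the expected value along \<open>\<chi>\<^sup>+\<close> many members of the sequence can be
  copied into each model of the chain over the members chosen so far, which yields an order.
\<close>

lemma few_exceptions_on_Morley_sequence:
  fixes \<chi> :: "'c rel" and s :: "'s rel"
  assumes k: "Cinfinite k" and \<chi>: "Card_order \<chi>" "lang_pow k N \<le>o \<chi>"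
    and no_op: "\<not> order_property k N (cardSuc \<chi>)"
    and \<alpha>: "\<alpha> \<in> Field k" and s: "Well_order s"
    and A: "|A| \<le>o ctwo ^c \<chi>" and ns: "nonsplitting k N \<alpha> c M A"
    and K: "\<And>\<xi>. \<xi> \<in> Field s \<Longrightarrow> A \<subseteq> K \<xi> \<and> K \<xi> \<subseteq> M \<and> saturated k N (cardSuc (ctwo ^c \<chi>)) (K \<xi>)"
    and K_mono: "\<And>\<eta> \<xi>. \<eta> \<in> underS s \<xi> \<Longrightarrow> K \<eta> \<subseteq> K \<xi>"
    and a: "\<And>\<xi>. \<xi> \<in> Field s \<Longrightarrow> a \<xi> \<in> tup k \<alpha> UNIV \<and> tp k N \<alpha> (a \<xi>) (K \<xi>) = tp k N \<alpha> c (K \<xi>)"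
    and a_below: "\<And>\<eta> \<xi>. \<eta> \<in> underS s \<xi> \<Longrightarrow> a \<eta> ` underS k \<alpha> \<subseteq> K \<xi>"
    and \<beta>: "\<beta> \<in> Field k" and \<phi>: "\<phi> \<in> qf k N \<alpha> \<beta>"
    and b: "b \<in> tup k \<beta> UNIV" and b\<^sub>0: "b\<^sub>0 \<in> tup k \<beta> M" "tp k N \<beta> b\<^sub>0 A = tp k N \<beta> b A"
  shows "\<not> cardSuc \<chi> \<le>o
    |{\<xi> \<in> Field s. holds k N (case_sum (a \<xi>) b) \<phi> \<noteq> holds k N (case_sum c b\<^sub>0) \<phi>}|"
proof
  assume large: "cardSuc \<chi> \<le>o
    |{\<xi> \<in> Field s. holds k N (case_sum (a \<xi>) b) \<phi> \<noteq> holds k N (case_sum c b\<^sub>0) \<phi>}|"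
  let ?X = "ctwo ^c \<chi>"
  have \<chi>_inf: "Cinfinite \<chi>" and k\<chi>: "k \<le>o \<chi>"
    using Cinfinite_if_lang_pow_le[OF k \<chi>] by auto
  have X: "Cinfinite ?X" "\<chi> \<le>o ?X"
    using \<chi>_inf by (auto simp: Cinfinite_ctwo_cexp ordLeq_ctwo_cexp)
  \<comment> \<open>The sign is chosen so that the predicted value is false, and the exceptional
    indices become those where \<psi> holds at \<open>b\<close>.\<close>
  define \<psi> where "\<psi> = (if holds k N (case_sum c b\<^sub>0) \<phi> then Neg \<phi> else \<phi>)"
  have \<psi>: "\<psi> \<in> qf k N \<alpha> \<beta>" "\<not> holds k N (case_sum c b\<^sub>0) \<psi>"
    using \<phi> by (auto simp: \<psi>_def Neg_in_qf)
  obtain g where g: "\<And>i. i \<in> Field (cardSuc \<chi>) \<Longrightarrow>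
      g i \<in> {\<xi> \<in> Field s. holds k N (case_sum (a \<xi>) b) \<phi> \<noteq> holds k N (case_sum c b\<^sub>0) \<phi>}"
    and g_mono: "\<And>i j. i \<in> Field (cardSuc \<chi>) \<Longrightarrow> j \<in> Field (cardSuc \<chi>) \<Longrightarrow> i \<noteq> j \<Longrightarrow>
      (i, j) \<in> cardSuc \<chi> \<Longrightarrow> g i \<in> underS s (g j)"
    using ex_strict_mono_into_subset[OF cardSuc_Well_order[OF \<chi>(1)] s _ large] by blast
  have gs: "g i \<in> Field s" "holds k N (case_sum (a (g i)) b) \<psi>" if "i \<in> Field (cardSuc \<chi>)" for i
    using g[OF that] by (auto simp: \<psi>_def)
  \<comment> \<open>\<open>A\<close> keeps the copy of \<open>b\<close> comparable with
    \<open>b\<^sub>0\<close> by nonsplitting; the earlier members make the copy behave like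
    \<open>b\<close> towards them.\<close>
  define D where "D i = A \<union> (\<Union>j\<in>underS (cardSuc \<chi>) i. a (g j) ` underS k \<alpha>)" for i
  have "\<exists>b'. b' \<in> tup k \<beta> (K (g i)) \<and> tp k N \<beta> b' (D i) = tp k N \<beta> b (D i)"
    if i: "i \<in> Field (cardSuc \<chi>)" for i
  proof -
    have "g j \<in> underS s (g i)" if "j \<in> underS (cardSuc \<chi>) i" for j
      using that i subsetD[OF underS_subset_Field that] by (intro g_mono) (auto simp: underS_def)
    then have DK: "D i \<subseteq> K (g i)"
      using K[OF gs(1)[OF i]] a_below unfolding D_def by blast
    have "|\<Union>j\<in>underS (cardSuc \<chi>) i. a (g j) ` underS k \<alpha>| \<le>o \<chi>"
      by (rule card_of_UNION_underS[OF \<chi>_inf card_of_tup_range[OF k k\<chi> \<alpha>]])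
    then have "|D i| \<le>o ?X"
      unfolding D_def using A X ordLeq_transitive by (intro Un_Cinfinite_bound) blast+
    then have "|D i| <o cardSuc ?X"
      using X(1) cardSuc_ordLeq_ordLess[of ?X "|D i|"] by (simp add: card_of_Card_order)
    then show ?thesis
      using saturated_realize[OF _ \<beta> DK _ b] K[OF gs(1)[OF i]] by metis
  qed
  then obtain b' where b': "\<And>i. i \<in> Field (cardSuc \<chi>) \<Longrightarrow> b' i \<in> tup k \<beta> (K (g i))"
    "\<And>i. i \<in> Field (cardSuc \<chi>) \<Longrightarrow> tp k N \<beta> (b' i) (D i) = tp k N \<beta> b (D i)"
    by metis
  have lt: "holds k N (case_sum (a (g i)) (b' j)) \<psi>"
    if i: "i \<in> Field (cardSuc \<chi>)" and j: "j \<in> Field (cardSuc \<chi>)" and "i \<noteq> j" "(i, j) \<in> cardSuc \<chi>" for i j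
  proof -
    have "i \<in> underS (cardSuc \<chi>) j"
      using that by (simp add: underS_def)
    then have "a (g i) \<in> tup k \<alpha> (D j)"
      using a[OF gs(1)[OF i]] by (subst tup_range_iff) (auto simp: D_def)
    then have "holds k N (case_sum (a (g i)) (b' j)) \<psi> \<longleftrightarrow> holds k N (case_sum (a (g i)) b) \<psi>"
      by (rule tp_eq_swapD[OF b'(2)[OF j] \<alpha> _ \<psi>(1)])
    with gs(2)[OF i] show ?thesis by simp
  qed
  \<comment> \<open>A copy made at stage j lies in \<open>K (g i)\<close> for all later i and for i
    = j. There \<open>a (g i)\<close> acts like c, and nonsplitting moves the copy to
    \<open>b\<^sub>0\<close>.\<close>
  have ge: "\<not> holds k N (case_sum (a (g i)) (b' j)) \<psi>"
    if i: "i \<in> Field (cardSuc \<chi>)" and j: "j \<in> Field (cardSuc \<chi>)" and "i = j \<or> (i, j) \<notin> cardSuc \<chi>" for i j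
  proof -
    have "j = i \<or> (j, i) \<in> cardSuc \<chi> \<and> j \<noteq> i"
      using that cardSuc_Well_order[OF \<chi>(1)] unfolding order_on_defs total_on_def by blast
    then have "K (g j) \<subseteq> K (g i)"
      using g_mono[OF j i] K_mono by blast
    then have "b' j \<in> tup k \<beta> (K (g i))"
      using b'(1)[OF j] by (rule subsetD[OF tup_mono])
    then have "holds k N (case_sum (a (g i)) (b' j)) \<psi> \<longleftrightarrow> holds k N (case_sum c (b' j)) \<psi>"
      using a[OF gs(1)[OF i]] by (intro tp_eqD[OF _ \<beta> _ \<psi>(1)]) simp_all
    also have "\<dots> \<longleftrightarrow> holds k N (case_sum c b\<^sub>0) \<psi>"
    proof (rule nonsplittingD[OF ns \<beta> \<psi>(1) _ b\<^sub>0(1)])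
      show "b' j \<in> tup k \<beta> M"
        using K[OF gs(1)[OF j]] by (intro subsetD[OF tup_mono b'(1)[OF j]]) simp
      have "tp k N \<beta> (b' j) A = tp k N \<beta> b A"
        using b'(2)[OF j] by (rule tp_eq_mono) (simp add: D_def)
      then show "tp k N \<beta> (b' j) A = tp k N \<beta> b\<^sub>0 A"
        by (simp add: b\<^sub>0(2))
    qed
    finally show ?thesis using \<psi>(2) by simp
  qed
  define Y where "Y = underS k \<alpha> <+> underS k \<beta>"
  have wf0: "wf_fm k N (underS k \<alpha> <+> underS k \<beta>) \<psi>"
    using \<psi>(1) by (simp add: qf_def)
  have wf: "wf_fm k N (Y <+> Y) (map_fm (map_sum Inl Inr) \<psi>)"
    unfolding wf_fm_map_fm by (rule wf_fm_mono[OF wf0]) (auto simp: Y_def)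
  have "|underS k \<alpha>| <o k" "|underS k \<beta>| <o k"
    using k \<alpha> \<beta> by (auto intro: card_of_underS)
  then have Yk: "|Y| <o k"
    unfolding Y_def using k
    by (intro card_of_Plus_ordLess_infinite_Field) (auto simp: cinfinite_def)
  define t where "t i = case_sum (a (g i)) (b' i)" for i
  have "order_property k N (cardSuc \<chi>)"
  proof (rule order_property_if_formula[OF k Yk wf, of _ t])
    fix i j assume i: "i \<in> Field (cardSuc \<chi>)" and j: "j \<in> Field (cardSuc \<chi>)"
    have o: "case_sum (t i) (t j) \<circ> map_sum Inl Inr = case_sum (a (g i)) (b' j)"
      by (auto simp: t_def split: sum.split)
    show "holds k N (case_sum (t i) (t j)) (map_fm (map_sum Inl Inr) \<psi>) \<longleftrightarrow> (i, j) \<in> cardSuc \<chi> \<and> i \<noteq> j"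
      unfolding holds_map_fm o using lt[OF i j] ge[OF i j] by blast
  qed
  with no_op show False by blast
qed

section \<open>Small saturated submodels\<close>

text \<open>Frees the assumption from its fixed type. Either \<open>l\<close> is isomorphic to a
  cardinal on that type, or it exceeds the size of every parameter set, and then
  \<open>cardSuc ?U\<close> admits the same parameter sets, namely all.\<close>

lemma saturated_if_saturated_for_one:
  fixes k :: "'k rel" and N :: "('f, 'r, 'k, 'a, 'z) struct_scheme" and l :: "'l rel"
  assumes one: "saturation_from_length_one k N S" and M: "M \<in> S"
    and l: "Card_order l" "lang_pow k N <o l" and sat: "saturated_for k N (ord_one k) l M"
  shows "saturated k N l M"
proof -
  let ?U = "|UNIV :: ('a + ('f, 'r, 'k) lseq) set|"
  have U: "Card_order (cardSuc ?U)" "?U <o cardSuc ?U"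
    by (auto intro: cardSuc_Card_order cardSuc_greater card_of_Card_order)
  have small: "|B| <o cardSuc ?U" if "inj_on h B" for h :: "'x \<Rightarrow> 'a + ('f, 'r, 'k) lseq" and B
    using card_of_ordLeqI[OF that, of UNIV] U(2) ordLeq_ordLess_trans by blast
  have "\<exists>\<mu> :: ('a + ('f, 'r, 'k) lseq) set rel. Card_order \<mu> \<and> lang_pow k N <o \<mu> \<and>
      (\<forall>A :: 'a set. |A| <o \<mu> \<longleftrightarrow> |A| <o l)"
  proof (cases "l \<le>o cardSuc ?U")
    case True
    then obtain \<mu> :: "('a + ('f, 'r, 'k) lseq) set rel" where \<mu>: "l =o \<mu>"
      using internalize_ordLeq[of l "cardSuc ?U"] by blast
    then have "Card_order \<mu>"
      using l(1) Card_order_ordIso2 by blast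
    moreover have "lang_pow k N <o \<mu>"
      by (rule ordLess_ordIso_trans[OF l(2) \<mu>])
    moreover have "|A| <o \<mu> \<longleftrightarrow> |A| <o l" for A :: "'a set"
      using ordLess_ordIso_trans[OF _ \<mu>] ordLess_ordIso_trans[OF _ ordIso_symmetric[OF \<mu>]] by blast
    ultimately show ?thesis by blast
  next
    case False
    then have *: "cardSuc ?U <o l"
      using not_ordLeq_iff_ordLess[OF card_order_on_well_order_on[OF U(1)]
          card_order_on_well_order_on[OF l(1)]] by blast
    have A: "|A| <o cardSuc ?U" for A :: "'a set"
      by (rule small[of Inl]) simp
    moreover have "lang_pow k N <o cardSuc ?U"
      unfolding lang_pow_def by (rule small[of Inr]) simp
    moreover have "|A| <o l" for A :: "'a set"
      using A * ordLess_transitive by blast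
    ultimately show ?thesis using U(1) by blast
  qed
  then obtain \<mu> :: "('a + ('f, 'r, 'k) lseq) set rel" where \<mu>: "Card_order \<mu>" "lang_pow k N <o \<mu>"
    and eq: "\<And>A :: 'a set. |A| <o \<mu> \<longleftrightarrow> |A| <o l" by blast
  have "saturated_for k N \<alpha> \<mu> M \<longleftrightarrow> saturated_for k N \<alpha> l M" for \<alpha>
    unfolding saturated_for_def eq by (rule refl)
  then show ?thesis
    using one[unfolded saturation_from_length_one_def, rule_format, of \<mu> M] \<mu> M sat
    unfolding saturated_def by simp
qed

text \<open>By stability at most \<mu> types over \<open>E\<close> have to be realized,
  \<open>M\<close> realizes them as \<mu> is below \<open>l\<close>, and Loewenheim-Skolem turns the
  result into a model without exceeding \<mu>.\<close>

lemma ex_realizing_submodel: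
  assumes k: "Cinfinite k" and \<mu>: "Card_order \<mu>" "lang_pow k N \<le>o \<mu>" "stable_in k N \<mu>"
    and ls: "lowenheim_skolem k N S" and M: "M \<in> S" "saturated k N l M" and l: "\<mu> <o l"
    and E: "E \<subseteq> M" "|E| \<le>o \<mu>"
  obtains E' where "E' \<in> S" "E \<subseteq> E'" "E' \<subseteq> M" "|E'| \<le>o \<mu>"
    and "\<And>c. c \<in> tup k (ord_one k) UNIV \<Longrightarrow>
      \<exists>c'\<in>tup k (ord_one k) E'. tp k N (ord_one k) c' E = tp k N (ord_one k) c E"
proof -
  let ?o = "ord_one k"
  have o: "?o \<in> Field k" by (rule ord_one_in_Field[OF k])
  have \<mu>_inf: "Cinfinite \<mu>" and k\<mu>: "k \<le>o \<mu>"
    using Cinfinite_if_lang_pow_le[OF k \<mu>(1,2)] by auto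
  have "|E| <o l" using E(2) l ordLeq_ordLess_trans by blast
  then have "\<forall>p\<in>types k N ?o E. \<exists>c. c \<in> tup k ?o M \<and> tp k N ?o c E = p"
    using saturated_realize[OF M(2) o E(1)] unfolding types_def by blast
  then obtain real where real: "\<And>p. p \<in> types k N ?o E \<Longrightarrow> real p \<in> tup k ?o M \<and> tp k N ?o (real p) E = p"
    by metis
  define D where "D = E \<union> (\<Union>p\<in>types k N ?o E. real p ` underS k ?o)"
  have DM: "D \<subseteq> M"
    using E(1) real unfolding D_def tup_range_iff[of _ _ _ M] by blast
  have "|types k N ?o E| \<le>o \<mu>"
    using \<mu>(3) E(2) unfolding stable_in_def by blast
  then have "|D| \<le>o \<mu>"
    unfolding D_def using card_of_tup_range[OF k k\<mu> o]
    by (intro Un_Cinfinite_bound UNION_Cinfinite_bound E(2) \<mu>_inf) blast+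
  then have "lang_pow k N +c |D| \<le>o \<mu>"
    using \<mu>(2) \<mu>_inf by (intro csum_cinfinite_bound) (auto simp: lang_pow_def card_of_Card_order)
  moreover obtain E' where E': "E' \<in> S" "D \<subseteq> E'" "E' \<subseteq> M" "|E'| \<le>o lang_pow k N +c |D|"
    using ls DM M(1) unfolding lowenheim_skolem_def by blast
  ultimately have "|E'| \<le>o \<mu>"
    using ordLeq_transitive by blast
  moreover have "\<exists>c'\<in>tup k ?o E'. tp k N ?o c' E = tp k N ?o c E" if "c \<in> tup k ?o UNIV" for c
  proof -
    let ?p = "tp k N ?o c E"
    have p: "?p \<in> types k N ?o E" using that by (auto simp: types_def)
    then have "real ?p ` underS k ?o \<subseteq> E'" using E'(2) by (auto simp: D_def)
    then have "real ?p \<in> tup k ?o E'"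
      using real[OF p] unfolding tup_range_iff[of _ _ _ E'] tup_range_iff[of _ _ _ M] by blast
    then show ?thesis using real[OF p] by blast
  qed
  ultimately show ?thesis
    using that[of E'] E' by (auto simp: D_def)
qed

text \<open>The realizing step is iterated along \<open>cardSuc r\<close>. By regularity of this
  successor, a subset of the union of size at most \<open>r\<close> lies in some stage, and a later
  stage realizes the types over it. This settles length one, from which the assumption on models
  gives all lengths.\<close>

lemma ex_small_saturated_submodel:
  fixes r :: "'r rel" and N :: "('f, 'r', 'k, 'a, 'z) struct_scheme"
  assumes k: "Cinfinite k" and r: "Card_order r" "lang_pow k N \<le>o r"
    and \<mu>: "Card_order \<mu>" "cardSuc r \<le>o \<mu>" "stable_in k N \<mu>"
    and chains: "chain_closed S" and ls: "lowenheim_skolem k N S"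
    and one: "saturation_from_length_one k N S"
    and M: "M \<in> S" "saturated k N l M" and l: "\<mu> <o l"
    and D: "D \<subseteq> M" "|D| \<le>o \<mu>"
  obtains K where "K \<in> S" "D \<subseteq> K" "K \<subseteq> M" "|K| \<le>o \<mu>" "saturated k N (cardSuc r) K"
proof -
  let ?o = "ord_one k"
  let ?\<Theta> = "cardSuc r"
  have o: "?o \<in> Field k" by (rule ord_one_in_Field[OF k])
  have r_inf: "Cinfinite r"
    using Cinfinite_if_lang_pow_le[OF k r] by auto
  have r\<mu>: "r \<le>o \<mu>"
    using ordLeq_transitive[OF cardSuc_ordLeq[OF r(1)] \<mu>(2)] .
  have lang\<mu>: "lang_pow k N \<le>o \<mu>"
    using ordLeq_transitive[OF r(2) r\<mu>] .
  have \<mu>_inf: "Cinfinite \<mu>"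
    using Cinfinite_if_lang_pow_le[OF k \<mu>(1) lang\<mu>] by auto
  have \<Theta>: "Card_order ?\<Theta>" "Well_order ?\<Theta>" "Field ?\<Theta> \<noteq> {}" "Cinfinite ?\<Theta>"
    using r(1) Cinfinite_cardSuc[OF r_inf]
    by (auto intro: cardSuc_Card_order cardSuc_Well_order dest: Field_cardSuc_not_empty)
  define E where "E f \<xi> = D \<union> (\<Union>\<eta>\<in>underS ?\<Theta> \<xi>. f \<eta>)" for f :: "'r set \<Rightarrow> 'a set" and \<xi>
  define P where "P f \<xi> E' \<longleftrightarrow> E' \<in> S \<and> E f \<xi> \<subseteq> E' \<and> E' \<subseteq> M \<and> |E'| \<le>o \<mu> \<and>
      (\<forall>c\<in>tup k ?o UNIV. \<exists>c'\<in>tup k ?o E'. tp k N ?o c' (E f \<xi>) = tp k N ?o c (E f \<xi>))" for f \<xi> E'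
  have "\<exists>f. \<forall>\<xi>. P f \<xi> (f \<xi>)"
  proof (rule dependent_wf_choice[OF wf_minus_Id[OF \<Theta>(2)]])
    fix f g :: "'r set \<Rightarrow> 'a set" and \<xi> E'
    assume "\<And>\<eta>. (\<eta>, \<xi>) \<in> ?\<Theta> - Id \<Longrightarrow> f \<eta> = g \<eta>"
    then have "E f \<xi> = E g \<xi>"
      by (auto simp: E_def underS_def)
    then show "P f \<xi> E' = P g \<xi> E'"
      by (simp add: P_def)
  next
    fix \<xi> f
    assume "\<And>\<eta>. (\<eta>, \<xi>) \<in> ?\<Theta> - Id \<Longrightarrow> P f \<eta> (f \<eta>)"
    then have f: "f \<eta> \<subseteq> M" "|f \<eta>| \<le>o \<mu>" if "\<eta> \<in> underS ?\<Theta> \<xi>" for \<eta>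
      using that by (auto simp: P_def underS_def)
    have "|underS ?\<Theta> \<xi>| \<le>o |Field ?\<Theta>|"
      by (rule card_of_mono1[OF underS_subset_Field])
    then have "|underS ?\<Theta> \<xi>| \<le>o \<mu>"
      using card_of_Field_ordIso[OF \<Theta>(1)] \<mu>(2) ordLeq_ordIso_trans ordLeq_transitive by metis
    then have "|E f \<xi>| \<le>o \<mu>"
      unfolding E_def using f(2)
      by (intro Un_Cinfinite_bound UNION_Cinfinite_bound D(2) \<mu>_inf) blast+
    moreover have "E f \<xi> \<subseteq> M"
      unfolding E_def using D(1) f(1) by blast
    ultimately obtain E' where "P f \<xi> E'"
      using ex_realizing_submodel[OF k \<mu>(1) lang\<mu> \<mu>(3) ls M l, of "E f \<xi>"] unfolding P_def by metis
    then show "\<exists>E'. P f \<xi> E'" by blast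
  qed
  then obtain f where f: "\<And>\<xi>. P f \<xi> (f \<xi>)" by blast
  have f_mono: "f \<eta> \<subseteq> E f \<xi>" if "\<eta> \<in> underS ?\<Theta> \<xi>" for \<eta> \<xi>
    using that by (auto simp: E_def)
  have f_ge: "E f \<xi> \<subseteq> f \<xi>" for \<xi>
    using f by (simp add: P_def)
  have incr: "f \<eta> \<subseteq> f \<xi>" if "(\<eta>, \<xi>) \<in> ?\<Theta>" for \<eta> \<xi>
  proof (cases "\<eta> = \<xi>")
    case False
    then have "\<eta> \<in> underS ?\<Theta> \<xi>" using that by (simp add: underS_def)
    then show ?thesis using f_mono f_ge by blast
  qed simp
  define K where "K = (\<Union>\<xi>\<in>Field ?\<Theta>. f \<xi>)"
  have "K \<in> S"
    unfolding K_def using f incr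
    by (intro chain_closed_Union[OF chains \<Theta>(2,3)]) (auto simp: increasing_def P_def)
  moreover have "D \<subseteq> K"
    unfolding K_def using \<Theta>(3) f_ge unfolding E_def by blast
  moreover have "K \<subseteq> M"
    unfolding K_def using f by (auto simp: P_def)
  moreover have "|K| \<le>o \<mu>"
    unfolding K_def using f ordIso_ordLeq_trans[OF card_of_Field_ordIso[OF \<Theta>(1)] \<mu>(2)]
    by (intro UNION_Cinfinite_bound \<mu>_inf) (auto simp: P_def)
  moreover have "saturated k N ?\<Theta> K"
  proof (rule saturated_if_saturated_for_one[OF one \<open>K \<in> S\<close> \<Theta>(1)])
    show "lang_pow k N <o ?\<Theta>"
      by (rule ordLeq_ordLess_trans[OF r(2) cardSuc_greater[OF r(1)]])
    show "saturated_for k N ?o ?\<Theta> K"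
      unfolding saturated_for_def
    proof (intro allI impI, elim conjE)
      fix A p assume A: "A \<subseteq> K" "|A| <o ?\<Theta>" and "p \<in> types k N ?o A"
      then obtain c where c: "c \<in> tup k ?o UNIV" "p = tp k N ?o c A"
        by (auto simp: types_def)
      have "|A| \<le>o r"
        using A(2) cardSuc_ordLeq_ordLess[OF r(1), of "|A|"] by (simp add: card_of_Card_order)
      then obtain \<eta> where \<eta>: "\<eta> \<in> Field ?\<Theta>" "A \<subseteq> f \<eta>"
        using cardSuc_UNION_Cinfinite[OF r_inf, of f A] A(1) incr
        by (auto simp: K_def relChain_def)
      \<comment> \<open>A later index is required: \<open>f \<eta>\<close> realizes the types over
        \<open>E f \<eta>\<close>, not those over itself.\<close>
      obtain \<xi> where \<xi>: "\<xi> \<in> Field ?\<Theta>" "\<eta> \<noteq> \<xi>" "(\<eta>, \<xi>) \<in> ?\<Theta>"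
        using infinite_Card_order_limit[OF \<Theta>(1) _ \<eta>(1)] \<Theta>(4) by (auto simp: cinfinite_def)
      have AE: "A \<subseteq> E f \<xi>"
        using \<eta>(2) f_mono[of \<eta> \<xi>] \<xi> by (auto simp: underS_def)
      obtain c' where c': "c' \<in> tup k ?o (f \<xi>)" "tp k N ?o c' (E f \<xi>) = tp k N ?o c (E f \<xi>)"
        using f[of \<xi>] c(1) unfolding P_def by blast
      have "c' \<in> tup k ?o K"
        by (rule subsetD[OF tup_mono c'(1)]) (use \<xi>(1) in \<open>auto simp: K_def\<close>)
      then show "\<exists>c\<in>tup k ?o K. tp k N ?o c A = p"
        using tp_eq_mono[OF c'(2) AE] c(2) by blast
    qed
  qed
  ultimately show ?thesis by (rule that)
qed

text \<open>Each stage has at most \<mu> predecessors, so what has been built stays of size at most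
  \<mu> and fits into a small saturated submodel, over which \<open>M\<close> realizes the type of c
  because \<mu> is below \<open>l\<close>.\<close>

lemma ex_Morley_sequence:
  fixes r :: "'r rel" and \<mu> :: "'m rel" and k :: "'k rel"
    and N :: "('f, 'r', 'k, 'a, 'z) struct_scheme"
  assumes k: "Cinfinite k" and r: "Card_order r" "lang_pow k N \<le>o r"
    and \<mu>: "Card_order \<mu>" "cardSuc r \<le>o \<mu>" "stable_in k N \<mu>"
    and chains: "chain_closed S" and ls: "lowenheim_skolem k N S"
    and one: "saturation_from_length_one k N S"
    and M: "M \<in> S" "saturated k N l M" and l: "\<mu> <o l"
    and D: "D \<subseteq> M" "|D| \<le>o \<mu>"
    and \<alpha>: "\<alpha> \<in> Field k" and c: "c \<in> tup k \<alpha> UNIV"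
  obtains K :: "'m set \<Rightarrow> 'a set" and a
  where "\<And>\<xi>. D \<subseteq> K \<xi>" "\<And>\<xi>. K \<xi> \<subseteq> M" "\<And>\<xi>. saturated k N (cardSuc r) (K \<xi>)"
    and "\<And>\<eta> \<xi>. \<eta> \<in> underS (cardSuc \<mu>) \<xi> \<Longrightarrow> K \<eta> \<subseteq> K \<xi>"
    and "\<And>\<xi>. a \<xi> \<in> tup k \<alpha> M" "\<And>\<xi>. tp k N \<alpha> (a \<xi>) (K \<xi>) = tp k N \<alpha> c (K \<xi>)"
    and "\<And>\<eta> \<xi>. \<eta> \<in> underS (cardSuc \<mu>) \<xi> \<Longrightarrow> a \<eta> ` underS k \<alpha> \<subseteq> K \<xi>"
proof -
  let ?\<Theta> = "cardSuc \<mu>"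
  have r\<mu>: "r \<le>o \<mu>"
    using ordLeq_transitive[OF cardSuc_ordLeq[OF r(1)] \<mu>(2)] .
  have \<mu>_inf: "Cinfinite \<mu>" and k\<mu>: "k \<le>o \<mu>"
    using Cinfinite_if_lang_pow_le[OF k \<mu>(1) ordLeq_transitive[OF r(2) r\<mu>]] by auto
  have \<Theta>: "Well_order ?\<Theta>"
    by (rule cardSuc_Well_order[OF \<mu>(1)])
  define G where "G f \<xi> = D \<union> (\<Union>\<eta>\<in>underS ?\<Theta> \<xi>. fst (f \<eta>) \<union> snd (f \<eta>) ` underS k \<alpha>)"
    for f :: "'m set \<Rightarrow> 'a set \<times> ('k \<Rightarrow> 'a)" and \<xi>
  define P where "P f \<xi> v \<longleftrightarrow> G f \<xi> \<subseteq> fst v \<and> fst v \<subseteq> M \<and> |fst v| \<le>o \<mu> \<and>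
      saturated k N (cardSuc r) (fst v) \<and> snd v \<in> tup k \<alpha> M \<and>
      tp k N \<alpha> (snd v) (fst v) = tp k N \<alpha> c (fst v)" for f \<xi> v
  have "\<exists>f. \<forall>\<xi>. P f \<xi> (f \<xi>)"
  proof (rule dependent_wf_choice[OF wf_minus_Id[OF \<Theta>]])
    fix f g :: "'m set \<Rightarrow> 'a set \<times> ('k \<Rightarrow> 'a)" and \<xi> v
    assume eq: "\<And>\<eta>. (\<eta>, \<xi>) \<in> ?\<Theta> - Id \<Longrightarrow> f \<eta> = g \<eta>"
    have "f \<eta> = g \<eta>" if "\<eta> \<in> underS ?\<Theta> \<xi>" for \<eta>
      using eq that by (auto simp: underS_def)
    then have "G f \<xi> = G g \<xi>"
      by (simp add: G_def)
    then show "P f \<xi> v = P g \<xi> v"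
      by (simp add: P_def)
  next
    fix \<xi> f
    assume "\<And>\<eta>. (\<eta>, \<xi>) \<in> ?\<Theta> - Id \<Longrightarrow> P f \<eta> (f \<eta>)"
    then have f: "fst (f \<eta>) \<subseteq> M" "|fst (f \<eta>)| \<le>o \<mu>" "snd (f \<eta>) \<in> tup k \<alpha> M"
      if "\<eta> \<in> underS ?\<Theta> \<xi>" for \<eta>
      using that by (auto simp: P_def underS_def)
    have "|G f \<xi>| \<le>o \<mu>"
      unfolding G_def using f(2) card_of_tup_range[OF k k\<mu> \<alpha>]
      by (intro Un_Cinfinite_bound card_of_UNION_underS D(2) \<mu>_inf)
    moreover have "G f \<xi> \<subseteq> M"
      using D(1) f(1,3) unfolding G_def tup_range_iff[of _ _ _ M] by blast
    ultimately obtain K where K: "G f \<xi> \<subseteq> K" "K \<subseteq> M" "|K| \<le>o \<mu>" "saturated k N (cardSuc r) K"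
      using ex_small_saturated_submodel[OF k r \<mu> chains ls one M l] by metis
    obtain a where "a \<in> tup k \<alpha> M" "tp k N \<alpha> a K = tp k N \<alpha> c K"
      using saturated_realize[OF M(2) \<alpha> K(2) ordLeq_ordLess_trans[OF K(3) l] c] by blast
    with K have "P f \<xi> (K, a)" by (simp add: P_def)
    then show "\<exists>v. P f \<xi> v" by blast
  qed
  then obtain f where f: "\<And>\<xi>. P f \<xi> (f \<xi>)" by blast
  have G: "G f \<xi> \<subseteq> fst (f \<xi>)" for \<xi>
    using f by (simp add: P_def)
  show ?thesis
  proof (rule that[of "\<lambda>\<xi>. fst (f \<xi>)" "\<lambda>\<xi>. snd (f \<xi>)"])
    show "D \<subseteq> fst (f \<xi>)" for \<xi>
      using G[of \<xi>] by (simp add: G_def)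
    show "fst (f \<eta>) \<subseteq> fst (f \<xi>)" "snd (f \<eta>) ` underS k \<alpha> \<subseteq> fst (f \<xi>)" if "\<eta> \<in> underS ?\<Theta> \<xi>" for \<eta> \<xi>
      using G[of \<xi>] that by (auto simp: G_def)
  qed (use f in \<open>auto simp: P_def\<close>)
qed

section \<open>Uniform subsequences and weak uniqueness\<close>

text \<open>A full average of the sequence over \<open>B\<close> is never formed. A single type
  shared by \<chi>^+ members plays its role: it is realized inside \<open>M\<close> from the outset,
  and on each instance of a formula it must give the predicted value.\<close>

lemma realize_type_in_union:
  fixes \<chi> :: "'c rel" and \<mu> :: "'m rel" and k :: "'k rel" and N :: "('f, 'r, 'k, 'a, 'z) struct_scheme"
  assumes k: "Cinfinite k" and \<chi>: "Card_order \<chi>" "lang_pow k N \<le>o \<chi>"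
    and no_op: "\<not> order_property k N (cardSuc \<chi>)"
    and \<mu>: "Card_order \<mu>" "cardSuc (ctwo ^c \<chi>) \<le>o \<mu>" "stable_in k N \<mu>"
    and chains: "chain_closed S" and ls: "lowenheim_skolem k N S"
    and one: "saturation_from_length_one k N S"
    and M: "M \<in> S" "saturated k N l M" and l: "\<mu> <o l"
    and U: "M \<subseteq> U" and B: "B \<subseteq> U" "|B| \<le>o \<mu>"
    and c: "c \<in> tup k (ord_one k) UNIV"
    and R: "splitting_like k N S R" and A: "A \<subseteq> M" "|A| \<le>o \<chi>" "R (tp k N (ord_one k) c U) A"
  obtains a where "a \<in> tup k (ord_one k) M" and "tp k N (ord_one k) a B = tp k N (ord_one k) c B"
proof -
  let ?o = "ord_one k" and ?X = "ctwo ^c \<chi>"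
  have o: "?o \<in> Field k" by (rule ord_one_in_Field[OF k])
  have \<chi>_inf: "Cinfinite \<chi>"
    using Cinfinite_if_lang_pow_le[OF k \<chi>] by auto
  have X: "Cinfinite ?X" "\<chi> \<le>o ?X"
    using \<chi>_inf by (auto simp: Cinfinite_ctwo_cexp ordLeq_ctwo_cexp)
  have X_card: "Card_order ?X" using X(1) by blast
  have langX: "lang_pow k N \<le>o ?X"
    by (rule ordLeq_transitive[OF \<chi>(2) X(2)])
  have X\<mu>: "?X \<le>o \<mu>"
    by (rule ordLeq_transitive[OF cardSuc_ordLeq[OF X_card] \<mu>(2)])
  have \<mu>_inf: "Cinfinite \<mu>"
    using Cinfinite_if_lang_pow_le[OF k \<mu>(1) ordLeq_transitive[OF langX X\<mu>]] by auto
  have "saturated k N (cardSuc ?X) M"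
    by (rule saturated_mono[OF M(2) ordLeq_transitive[OF \<mu>(2) ordLess_imp_ordLeq[OF l]]])
  then obtain A' where A': "A' \<subseteq> M" "|A'| \<le>o ?X" "nonsplitting k N ?o c M A'"
    using ex_nonsplitting_base[OF k \<chi> no_op _ o c] by metis
  \<comment> \<open>A common base: \<open>A\<close> serves the R-nonsplitting of the type over
    \<open>U\<close>, \<open>A'\<close> the ordinary nonsplitting over \<open>M\<close>.\<close>
  define C where "C = A \<union> A'"
  have CM: "C \<subseteq> M" using A(1) A'(1) by (simp add: C_def)
  have CX: "|C| \<le>o ?X"
    unfolding C_def by (intro Un_Cinfinite_bound A'(2) X(1) ordLeq_transitive[OF A(2) X(2)])
  have ns: "nonsplitting k N ?o c M C"
    by (rule nonsplitting_mono[OF A'(3)]) (simp add: C_def)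
  \<comment> \<open>Weak uniqueness requires a saturated model below both types. \<open>M\<close>
    may be too large to be added to \<open>B\<close>; with this small model the base still has at
    most \<mu> elements, so stability bounds the types over it.\<close>
  obtain K\<^sub>0 where K\<^sub>0: "K\<^sub>0 \<in> S" "C \<subseteq> K\<^sub>0" "K\<^sub>0 \<subseteq> M" "|K\<^sub>0| \<le>o \<mu>" "saturated k N (cardSuc ?X) K\<^sub>0"
    using ex_small_saturated_submodel[OF k X_card langX \<mu> chains ls one M l CM ordLeq_transitive[OF CX X\<mu>]]
    by metis
  obtain K :: "'m set \<Rightarrow> 'a set" and a
    where K: "\<And>\<xi>. K\<^sub>0 \<subseteq> K \<xi>" "\<And>\<xi>. K \<xi> \<subseteq> M" "\<And>\<xi>. saturated k N (cardSuc ?X) (K \<xi>)"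
      "\<And>\<eta> \<xi>. \<eta> \<in> underS (cardSuc \<mu>) \<xi> \<Longrightarrow> K \<eta> \<subseteq> K \<xi>"
      and a: "\<And>\<xi>. a \<xi> \<in> tup k ?o M" "\<And>\<xi>. tp k N ?o (a \<xi>) (K \<xi>) = tp k N ?o c (K \<xi>)"
      "\<And>\<eta> \<xi>. \<eta> \<in> underS (cardSuc \<mu>) \<xi> \<Longrightarrow> a \<eta> ` underS k ?o \<subseteq> K \<xi>"
    using ex_Morley_sequence[OF k X_card langX \<mu> chains ls one M l K\<^sub>0(3,4) o c] by metis
  have a_UNIV: "a \<xi> \<in> tup k ?o UNIV" for \<xi>
    using a(1)[of \<xi>] tup_range_iff by metis
  define B' where "B' = K\<^sub>0 \<union> B"
  have B': "K\<^sub>0 \<subseteq> B'" "C \<subseteq> B'" "B \<subseteq> B'" "B' \<subseteq> U"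
    using K\<^sub>0(2,3) U B(1) by (auto simp: B'_def)
  have "|B'| \<le>o \<mu>"
    unfolding B'_def by (intro Un_Cinfinite_bound K\<^sub>0(4) B(2) \<mu>_inf)
  then have "|types k N ?o B'| \<le>o \<mu>"
    using \<mu>(3) unfolding stable_in_def by blast
  moreover have "(\<lambda>\<xi>. tp k N ?o (a \<xi>) B') ` Field (cardSuc \<mu>) \<subseteq> types k N ?o B'"
    using a_UNIV by (auto simp: types_def)
  ultimately obtain y where y: "cardSuc \<chi> \<le>o |{\<xi> \<in> Field (cardSuc \<mu>). tp k N ?o (a \<xi>) B' = y}|"
    using pigeonhole_cardinal[OF \<mu>_inf \<chi>(1) ordLeq_transitive[OF X(2) X\<mu>],
        of "\<lambda>\<xi>. tp k N ?o (a \<xi>) B'" "types k N ?o B'"] by metis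
  let ?Y = "{\<xi> \<in> Field (cardSuc \<mu>). tp k N ?o (a \<xi>) B' = y}"
  have "?Y \<noteq> {}"
    using y Field_cardSuc_not_empty[OF \<chi>(1)] by (metis card_of_empty3 card_of_Field_ordIso
        cardSuc_Card_order[OF \<chi>(1)] ordIso_ordLeq_trans)
  then obtain \<xi>\<^sub>1 where \<xi>\<^sub>1: "tp k N ?o (a \<xi>\<^sub>1) B' = y" by blast
  have y_type: "y \<in> all_types k N B'"
    using \<xi>\<^sub>1 a_UNIV o unfolding all_types_def types_def by blast
  have "\<not> splits k N y C"
  proof
    assume "splits k N y C"
    then obtain \<alpha>' \<beta> \<phi> b b' where \<beta>: "\<beta> \<in> Field k" and \<phi>': "\<phi> \<in> qf k N \<alpha>' \<beta>"
      and b: "b \<in> tup k \<beta> UNIV" "b' \<in> tup k \<beta> UNIV" "tp k N \<beta> b' C = tp k N \<beta> b C"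
      and y_b: "inst b \<phi> \<in> y" "inst b' (Neg \<phi>) \<in> y"
      unfolding splits_def inst_Neg by blast
    have \<phi>: "\<phi> \<in> qf k N ?o \<beta>"
      using inst_in_tpD(1)[OF _ \<phi>'] y_b(1) \<xi>\<^sub>1 by blast
    have "|C| <o cardSuc ?X"
      using CX cardSuc_ordLeq_ordLess[OF X_card, of "|C|"] by (simp add: card_of_Card_order)
    \<comment> \<open>The copy of \<open>b\<close> in \<open>M\<close> fixes the predicted value. It
      has the type of \<open>b'\<close> over \<open>C\<close> as well, so both parameters receive
      the same prediction.\<close>
    then obtain b\<^sub>0 where b\<^sub>0: "b\<^sub>0 \<in> tup k \<beta> K\<^sub>0" "tp k N \<beta> b\<^sub>0 C = tp k N \<beta> b C"
      using saturated_realize[OF K\<^sub>0(5) \<beta> K\<^sub>0(2) _ b(1)] by blast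
    have b\<^sub>0M: "b\<^sub>0 \<in> tup k \<beta> M"
      by (rule subsetD[OF tup_mono[OF K\<^sub>0(3)] b\<^sub>0(1)])
    have few: "\<not> cardSuc \<chi> \<le>o
        |{\<xi> \<in> Field (cardSuc \<mu>). holds k N (case_sum (a \<xi>) d) \<phi> \<noteq> holds k N (case_sum c b\<^sub>0) \<phi>}|"
      if "d \<in> tup k \<beta> UNIV" "tp k N \<beta> b\<^sub>0 C = tp k N \<beta> d C" for d
    proof (rule few_exceptions_on_Morley_sequence[where M = M and A = C and K = K])
      show "C \<subseteq> K \<xi> \<and> K \<xi> \<subseteq> M \<and> saturated k N (cardSuc ?X) (K \<xi>)" for \<xi>
        using K(1-3) K\<^sub>0(2) by blast
      show "a \<xi> \<in> tup k ?o UNIV \<and> tp k N ?o (a \<xi>) (K \<xi>) = tp k N ?o c (K \<xi>)" for \<xi>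
        using a(2) a_UNIV by simp
      show "Well_order (cardSuc \<mu>)"
        by (rule cardSuc_Well_order[OF \<mu>(1)])
    qed (use k \<chi> no_op o CX ns K(4) a(3) \<beta> \<phi> that b\<^sub>0M in auto)
    have in_Y: "holds k N (case_sum (a \<xi>) b) \<phi> \<and> \<not> holds k N (case_sum (a \<xi>) b') \<phi>" if "\<xi> \<in> ?Y" for \<xi>
      using inst_in_tpD(2)[of b \<phi> k N ?o "a \<xi>" B' \<alpha>' \<beta>]
        inst_in_tpD(2)[of b' "Neg \<phi>" k N ?o "a \<xi>" B' \<alpha>' \<beta>] y_b \<phi>' Neg_in_qf[OF \<phi>'] that by simp
    \<comment> \<open>The exceptions are too few to contain \<open>?Y\<close>, so some index in
      \<open>?Y\<close> is regular. As all indices in \<open>?Y\<close> agree at \<open>b\<close>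
      and at \<open>b'\<close>, one regular index for each forces contradictory predictions.\<close>
    have sub: "\<not> ?Y \<subseteq> {\<xi> \<in> Field (cardSuc \<mu>). holds k N (case_sum (a \<xi>) d) \<phi> \<noteq> holds k N (case_sum c b\<^sub>0) \<phi>}"
      if "d \<in> tup k \<beta> UNIV" "tp k N \<beta> b\<^sub>0 C = tp k N \<beta> d C" for d
      using few[OF that] ordLeq_transitive[OF y card_of_mono1] by blast
    have "holds k N (case_sum c b\<^sub>0) \<phi>"
      using sub[OF b(1) b\<^sub>0(2)] in_Y by blast
    moreover have "\<not> holds k N (case_sum c b\<^sub>0) \<phi>"
      using sub[OF b(2)] b\<^sub>0(2) b(3) in_Y by auto
    ultimately show False by blast
  qed
  then have Ry: "R y C"
    using R y_type B'(2) unfolding splitting_like_def by blast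
  have U_type: "tp k N ?o c U \<in> all_types k N U"
    using c o unfolding all_types_def types_def by blast
  have "R (type_restr k N (tp k N ?o c U) B') C"
    using R[unfolded splitting_like_def, THEN conjunct1, rule_format, of "tp k N ?o c U" U A C B']
      U_type A(3) B'(2,4) by (simp add: C_def)
  then have Rc: "R (tp k N ?o c B') C"
    by (simp add: type_restr_tp[OF o B'(4)])
  have c_type: "tp k N ?o c B' \<in> all_types k N B'"
    using c o unfolding all_types_def types_def by blast
  have "|C| +c lang_pow k N \<le>o ?X"
    using CX langX X(1) by (intro csum_cinfinite_bound) (auto simp: lang_pow_def card_of_Card_order)
  then have "cardSuc ( |C| +c lang_pow k N) \<le>o cardSuc ?X"
    using cardSuc_mono_ordLeq[OF Card_order_csum X_card] by blast
  then have K\<^sub>0_sat: "saturated k N (cardSuc ( |C| +c lang_pow k N)) K\<^sub>0"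
    by (rule saturated_mono[OF K\<^sub>0(5)])
  have "type_restr k N y K\<^sub>0 = tp k N ?o (a \<xi>\<^sub>1) K\<^sub>0"
    unfolding \<xi>\<^sub>1[symmetric] by (rule type_restr_tp[OF o B'(1)])
  also have "\<dots> = tp k N ?o c K\<^sub>0"
    by (rule tp_eq_mono[OF a(2) K(1)])
  also have "\<dots> = type_restr k N (tp k N ?o c B') K\<^sub>0"
    by (rule type_restr_tp[OF o B'(1), symmetric])
  finally have restr: "type_restr k N y K\<^sub>0 = type_restr k N (tp k N ?o c B') K\<^sub>0" .
  have "y = tp k N ?o c B'"
    using R[unfolded splitting_like_def, THEN conjunct2, THEN conjunct1, rule_format,
        of K\<^sub>0 C B' y "tp k N ?o c B'"] K\<^sub>0(1,2) B'(1) K\<^sub>0_sat y_type c_type Ry Rc restr by blast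
  then have "tp k N ?o (a \<xi>\<^sub>1) B' = tp k N ?o c B'"
    by (simp add: \<xi>\<^sub>1)
  then have "tp k N ?o (a \<xi>\<^sub>1) B = tp k N ?o c B"
    by (rule tp_eq_mono[OF _ B'(3)])
  with a(1) show ?thesis by (rule that)
qed

text \<open>Types of length one suffice once the union is known to be a model. For such a type over
  B, hypothesis (3), applied to the type of a realization over the whole union, selects the model in
  which B's type is realized.\<close>

theorem theorem5p27:
  fixes \<kappa> :: "'k rel"
    and N :: "('f, 'r, 'k, 'a) struct"
    and S :: "'a set set"
    and \<chi>\<^sub>0 :: "'c rel"
    and \<chi> :: "(('c \<Rightarrow> bool) \<Rightarrow> bool) set rel"
    and l :: "'l rel"
    and \<delta> :: "'d rel"
    and M :: "'d \<Rightarrow> 'a set"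
  assumes kappa: "Cinfinite \<kappa>"
    and language: "lt_ary \<kappa> N"
    and chains: "chain_closed S"
    and ls: "lowenheim_skolem \<kappa> N S"
    and length_one: "saturation_from_length_one \<kappa> N S"
    and chi0_card: "Card_order \<chi>\<^sub>0"
    and chi0: "lang_pow \<kappa> N \<le>o \<chi>\<^sub>0"
    and no_op: "\<not> order_property \<kappa> N (cardSuc \<chi>\<^sub>0)"
    and chi: "\<chi> = cardSuc (ctwo ^c (ctwo ^c \<chi>\<^sub>0))"
    and l_card: "Card_order l"
    and l_gt: "cardSuc \<chi> <o l"
    and stable: "\<forall>\<nu> :: 'l rel. Card_order \<nu> \<and> \<nu> <o l \<longrightarrow>
        (\<exists>\<mu> :: 'l rel. Card_order \<mu> \<and> \<nu> \<le>o \<mu> \<and> \<mu> <o l \<and> stable_in \<kappa> N \<mu>)"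
    and delta: "Well_order \<delta>"
    and incr: "increasing \<delta> M"
    and models: "\<forall>i\<in>Field \<delta>. M i \<in> S \<and> saturated \<kappa> N l (M i)"
    and nonsplitting: "\<forall>q \<in> types \<kappa> N (ord_one \<kappa>) (\<Union>i\<in>Field \<delta>. M i).
        \<exists>R. splitting_like \<kappa> N S R \<and>
          (\<exists>i\<in>Field \<delta>. \<exists>A. A \<subseteq> M i \<and> |A| \<le>o \<chi>\<^sub>0 \<and> R q A)"
  shows "saturated \<kappa> N l (\<Union>i\<in>Field \<delta>. M i)"
proof -
  let ?U = "\<Union>i\<in>Field \<delta>. M i" and ?o = "ord_one \<kappa>" and ?X = "ctwo ^c \<chi>\<^sub>0"
  let ?\<Theta> = "cardSuc ?X"
  have X: "Card_order ?X" "Card_order (ctwo ^c ?X)" "Card_order \<chi>"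
    by (auto simp: Card_order_cexp chi intro: cardSuc_Card_order)
  have chi0_inf: "Cinfinite \<chi>\<^sub>0"
    using Cinfinite_if_lang_pow_le[OF kappa chi0_card chi0] by auto
  have \<Theta>: "Card_order ?\<Theta>" "Cinfinite ?\<Theta>"
    using Cinfinite_cardSuc[OF Cinfinite_ctwo_cexp[OF chi0_inf]] by auto
  \<comment> \<open>The lower bound on \<open>l\<close> places the saturation degree of the small
    models below it.\<close>
  have "?\<Theta> \<le>o ctwo ^c ?X"
    by (rule cardSuc_least[OF X(1,2) ordLess_ctwo_cexp[OF X(1)]])
  also have "ctwo ^c ?X \<le>o \<chi>"
    unfolding chi by (rule cardSuc_ordLeq[OF X(2)])
  also have "\<chi> \<le>o cardSuc \<chi>"
    by (rule cardSuc_ordLeq[OF X(3)])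
  finally have \<Theta>l: "?\<Theta> <o l"
    using l_gt ordLeq_ordLess_trans by blast
  have l_inf: "Cinfinite l"
    using cinfinite_mono[OF ordLess_imp_ordLeq[OF \<Theta>l]] \<Theta>(2) l_card by blast
  have "lang_pow \<kappa> N <o ?\<Theta>"
    using ordLeq_ordLess_trans[OF ordLeq_transitive[OF chi0 ordLeq_ctwo_cexp[OF chi0_card]]
        cardSuc_greater[OF X(1)]] .
  then have lang_l: "lang_pow \<kappa> N <o l"
    using \<Theta>l ordLess_transitive by blast
  have realized: "\<exists>a\<in>tup \<kappa> ?o ?U. tp \<kappa> N ?o a B = tp \<kappa> N ?o c B"
    if B: "B \<subseteq> ?U" "|B| <o l" and c: "c \<in> tup \<kappa> ?o UNIV" for B c
  proof -
    have "tp \<kappa> N ?o c ?U \<in> types \<kappa> N ?o ?U"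
      using c by (auto simp: types_def)
    then obtain R i A where R: "splitting_like \<kappa> N S R" and i: "i \<in> Field \<delta>"
      and A: "A \<subseteq> M i" "|A| \<le>o \<chi>\<^sub>0" "R (tp \<kappa> N ?o c ?U) A"
      using nonsplitting by blast
    \<comment> \<open>The sum forces the stability cardinal above both the size of \<open>B\<close>
      and \<open>?\<Theta>\<close>. It is then copied to the type \<open>'l\<close>, where the
      stability hypothesis ranges over cardinals.\<close>
    have "|B <+> Field ?\<Theta>| <o l"
      using B(2) l_inf ordIso_ordLess_trans[OF card_of_Field_ordIso[OF \<Theta>(1)] \<Theta>l]
      by (intro card_of_Plus_ordLess_infinite_Field) (auto simp: cinfinite_def)
    then obtain Y :: "'l set" where Y: "|B <+> Field ?\<Theta>| =o |Y|" "|Y| <o l"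
      using internalize_card_of_ordLess[of "B <+> Field ?\<Theta>" l] by blast
    obtain \<mu> :: "'l rel" where \<mu>: "Card_order \<mu>" "|Y| \<le>o \<mu>" "\<mu> <o l" "stable_in \<kappa> N \<mu>"
      using stable[rule_format, of "|Y|"] card_of_Card_order[of Y] Y(2) by blast
    have sum_le: "|B <+> Field ?\<Theta>| \<le>o \<mu>"
      by (rule ordIso_ordLeq_trans[OF Y(1) \<mu>(2)])
    have B\<mu>: "|B| \<le>o \<mu>"
      by (rule ordLeq_transitive[OF card_of_Plus1 sum_le])
    have \<Theta>\<mu>: "?\<Theta> \<le>o \<mu>"
      using ordLeq_transitive[OF Card_order_Plus2[OF \<Theta>(1)] sum_le] .
    have MiU: "M i \<subseteq> ?U" using i by blast
    have Mi: "M i \<in> S" "saturated \<kappa> N l (M i)" using models i by auto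
    obtain a where a: "a \<in> tup \<kappa> ?o (M i)" "tp \<kappa> N ?o a B = tp \<kappa> N ?o c B"
      using realize_type_in_union[OF kappa chi0_card chi0 no_op \<mu>(1) \<Theta>\<mu> \<mu>(4) chains ls length_one
          Mi \<mu>(3) MiU B(1) B\<mu> c R A] by blast
    then show ?thesis
      using subsetD[OF tup_mono[OF MiU] a(1)] by blast
  qed
  \<comment> \<open>Some type exists over any set, even the empty union, and the nonsplitting
    hypothesis for it provides an index, so the chain is nonempty.\<close>
  have "(\<lambda>x\<in>underS \<kappa> ?o. undefined) \<in> tup \<kappa> ?o (UNIV :: 'a set)"
    by (simp add: tup_def)
  then have "types \<kappa> N ?o ?U \<noteq> {}"
    by (auto simp: types_def)
  then have "Field \<delta> \<noteq> {}"
    using nonsplitting by blast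
  then have "?U \<in> S"
    using models by (intro chain_closed_Union[OF chains delta _ incr]) auto
  then show ?thesis
  proof (rule saturated_if_saturated_for_one[OF length_one _ l_card lang_l])
    show "saturated_for \<kappa> N ?o l ?U"
      unfolding saturated_for_def types_def using realized by blast
  qed
qed

end
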